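(* Let $0<\alpha<\omega_1$ be a countable ordinal, let $K$ be a compact Hausdorff space with $K^{(\alpha)}\neq\varnothing$, and assume that the field of scalars is $\mathbb{C}$. Let $\beta\in\omega_1$ be such that $\omega^\beta\le\alpha<\omega^{\beta+1}$. Then $C(K)$ contains an isometric SPR copy of $C[1,\omega^\gamma]$ for every ordinal $\gamma<\omega^\beta$. Moreover, if $|K^{(\omega^\beta\cdot 2)}|\ge 2$, that is, if $\alpha>\omega^\beta\cdot 2$ or $\alpha=\omega^\beta\cdot 2$ and $|K^{(\alpha)}|\ge 2$, then $C(K)$ contains an isomorphic SPR copy of $C[1,\omega^\alpha]$.
   Context: $C(K)$ is the space of complex-valued continuous functions on $K$ with the supremum norm. A complex linear subspace $E$ of $C(K)$ does $C$-stable phase retrieval ($C$-SPR), for a constant $C\ge1$, if $\inf_{\lambda\in\mathbb{C},|\lambda|=1}\|f-\lambda g\|\le C\,\big\||f|-|g|\big\|$ for all $f,g\in E$; it does SPR if it does $C$-SPR for some $C\ge1$. $C(K)$ contains an isometric (resp. isomorphic) SPR copy of a Banach space $X$ if there is a linear isometric embedding (resp. a linear isomorphism onto its range) $X\to C(K)$ whose range does SPR. Cantor--Bendixson derivatives: for a topological space $T$, $T'$ is the set of its non-isolated points; $K^{(0)}=K$, $K^{(\delta+1)}=(K^{(\delta)})'$ (with $K^{(\delta)}$ in the subspace topology), and $K^{(\delta)}=\bigcap_{\eta<\delta}K^{(\eta)}$ for limit ordinals $\delta$. $|S|$ denotes the cardinality of a set $S$. $\omega$ is the first infinite ordinal, $\omega_1$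 is the first uncountable ordinal, operations on ordinals are those of ordinal arithmetic, and for an ordinal $\delta$, $[1,\omega^\delta]$ is the set of ordinals $\eta$ with $1\le\eta\le\omega^\delta$ with the order topology; $C[1,\omega^\delta]$ is the space of complex-valued continuous functions on it with the supremum norm.
   Formalization: The "that is" equivalence is stated only when ω^β·2 ≤ α, since it fails otherwise (e.g. K=[0,1], α=1); the isomorphic copy is proved whenever |K^(ω^β·2)| ≥ 2, which covers both forms of the condition. *)

theory Defs
  imports "HOL-Analysis.Analysis" "HOL-Library.Countable_Set_Type"
begin

section \<open>Countable ordinals\<close>

text \<open>The ordinal \<open>\<omega>\<^sub>1\<close> is the successor cardinal of \<open>\<aleph>\<^sub>0\<close>. The elements of the following
  type are the ordinals below it, i.e. the countable ordinals.\<close>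

typedef omega1 = "Field (cardSuc natLeq)"
proof -
  have "Field (cardSuc natLeq) \<noteq> {}"
    using Field_cardSuc_not_empty[OF natLeq_Card_order] .
  then show ?thesis by blast
qed

lemma Well_order_cardSuc_natLeq: "Well_order (cardSuc natLeq)"
  using cardSuc_Card_order[OF natLeq_Card_order] by (simp add: card_order_on_def)

instantiation omega1 :: wellorder
begin

definition less_eq_omega1 :: "omega1 \<Rightarrow> omega1 \<Rightarrow> bool"
  where "a \<le> b \<longleftrightarrow> (Rep_omega1 a, Rep_omega1 b) \<in> cardSuc natLeq"

definition less_omega1 :: "omega1 \<Rightarrow> omega1 \<Rightarrow> bool"
  where "a < b \<longleftrightarrow> a \<le> b \<and> a \<noteq> (b::omega1)"

instance
proof
  fix x y z :: omega1
  have wo: "Refl (cardSuc natLeq)" "trans (cardSuc natLeq)" "antisym (cardSuc natLeq)"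
    "Total (cardSuc natLeq)" "wf (cardSuc natLeq - Id)"
    using Well_order_cardSuc_natLeq by (auto simp: order_on_defs)
  show "x \<le> x"
    using wo(1) Rep_omega1[of x] by (auto simp: less_eq_omega1_def refl_on_def)
  show anti: "x \<le> y \<Longrightarrow> y \<le> x \<Longrightarrow> x = y"
    using wo(3) unfolding less_eq_omega1_def by (metis antisymD Rep_omega1_inject)
  show "(x < y) = (x \<le> y \<and> \<not> y \<le> x)"
    using anti \<open>x \<le> x\<close> by (auto simp: less_omega1_def)
  show "x \<le> y \<Longrightarrow> y \<le> z \<Longrightarrow> x \<le> z"
    using wo(2) by (auto simp: less_eq_omega1_def dest: transD)
  show "x \<le> y \<or> y \<le> x"
    using wo(4) Rep_omega1[of x] Rep_omega1[of y] \<open>x \<le> x\<close>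
    by (cases "x = y") (auto simp: less_eq_omega1_def total_on_def Rep_omega1_inject)
next
  fix P :: "omega1 \<Rightarrow> bool" and a
  assume step: "\<And>x. (\<And>y. y < x \<Longrightarrow> P y) \<Longrightarrow> P x"
  have "wf (cardSuc natLeq - Id)"
    using Well_order_cardSuc_natLeq by (auto simp: order_on_defs)
  then have "wf (inv_image (cardSuc natLeq - Id) Rep_omega1)" by simp
  moreover have "inv_image (cardSuc natLeq - Id) Rep_omega1 = {(x, y). x < y}"
    by (auto simp: inv_image_def less_omega1_def less_eq_omega1_def Rep_omega1_inject)
  ultimately have "wf {(x, y :: omega1). x < y}" by simp
  then show "P a"
    by (induction a rule: wf_induct_rule) (use step in auto)
qed

end

lemma countable_lessThan_omega1: "countable {..<a :: omega1}"
proof -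
  include cardinal_syntax
  have "card_of (underS (cardSuc natLeq) (Rep_omega1 a)) <o cardSuc natLeq"
    using card_of_underS[OF cardSuc_Card_order[OF natLeq_Card_order] Rep_omega1] .
  then have "card_of (underS (cardSuc natLeq) (Rep_omega1 a)) \<le>o natLeq"
    using cardSuc_ordLeq_ordLess[OF natLeq_Card_order card_of_Card_order] by blast
  then have "countable (underS (cardSuc natLeq) (Rep_omega1 a))"
    by (simp add: countable_card_le_natLeq)
  moreover have "Rep_omega1 ` {..<a} \<subseteq> underS (cardSuc natLeq) (Rep_omega1 a)"
    by (auto simp: underS_def less_omega1_def less_eq_omega1_def Rep_omega1_inject)
  ultimately show ?thesis
    by (meson Rep_omega1_inject countable_image_inj_on countable_subset inj_onI)
qed

lemma uncountable_UNIV_omega1: "uncountable (UNIV :: omega1 set)"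
proof
  include cardinal_syntax
  assume "countable (UNIV :: omega1 set)"
  then have "countable (Field (cardSuc natLeq))"
    using type_definition.Rep_range[OF type_definition_omega1] by (metis countable_image)
  then have "card_of (Field (cardSuc natLeq)) \<le>o natLeq"
    by (simp add: countable_card_le_natLeq)
  moreover have "natLeq <o cardSuc natLeq"
    by (rule cardSuc_greater[OF natLeq_Card_order])
  moreover have "cardSuc natLeq =o card_of (Field (cardSuc natLeq))"
    by (meson card_of_Field_ordIso cardSuc_Card_order natLeq_Card_order ordIso_symmetric)
  ultimately show False
    by (meson not_ordLess_ordLeq ordLess_ordIso_trans)
qed

lemma countable_bounded_omega1:
  fixes A :: "omega1 set"
  assumes "countable A"
  shows "\<exists>b. \<forall>a\<in>A. a < b"
proof (rule ccontr)
  assume "\<not> ?thesis"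
  then have "UNIV = (\<Union>a\<in>A. insert a {..<a})"
    by (force simp: not_less le_less)
  moreover have "countable (\<Union>a\<in>A. insert a {..<a})"
    using assms countable_lessThan_omega1 by auto
  ultimately show False using uncountable_UNIV_omega1 by metis
qed

instantiation omega1 :: zero_neq_one
begin

definition zero_omega1 :: omega1 where "0 = (LEAST a :: omega1. True)"

definition one_omega1 :: omega1 where "1 = (LEAST a :: omega1. 0 < a)"

instance
proof
  obtain b :: omega1 where "0 < b"
    using countable_bounded_omega1[of "{0}"] by auto
  then have "0 < (1 :: omega1)"
    unfolding one_omega1_def by (rule LeastI)
  then show "0 \<noteq> (1 :: omega1)" by simp
qed

end

definition osuc :: "omega1 \<Rightarrow> omega1"
  where "osuc a = (LEAST b. a < b)"

definition limit_ord :: "omega1 \<Rightarrow> bool"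
  where "limit_ord a \<longleftrightarrow> a \<noteq> 0 \<and> (\<forall>b. a \<noteq> osuc b)"

text \<open>Only used for countable sets, which do have a supremum below \<open>\<omega>\<^sub>1\<close>.\<close>

definition osup :: "omega1 set \<Rightarrow> omega1"
  where "osup A = (LEAST b. \<forall>a\<in>A. a \<le> b)"

definition omega :: omega1
  where "omega = (LEAST a. infinite {..<a})"

lemma zero_le_omega1 [simp]: "0 \<le> (a :: omega1)"
  unfolding zero_omega1_def by (rule Least_le) simp

lemma less_osuc: "a < osuc a"
proof -
  obtain b where "a < b" using countable_bounded_omega1[of "{a}"] by auto
  then show ?thesis unfolding osuc_def by (rule LeastI)
qed

lemma less_osuc_iff [simp]: "b < osuc a \<longleftrightarrow> b \<le> a"
  by (metis less_osuc osuc_def le_less_trans not_less not_less_Least)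

lemma osuc_neq_zero [simp]: "osuc a \<noteq> 0" "0 \<noteq> osuc a"
  using less_osuc[of a] zero_le_omega1[of a] by (metis not_le)+

lemma osuc_inject [simp]: "osuc a = osuc b \<longleftrightarrow> a = b"
  by (metis less_osuc_iff order.antisym order.refl)

lemma osuc_zero: "osuc 0 = (1 :: omega1)"
  by (simp add: osuc_def one_omega1_def)

lemma omega1_cases:
  obtains "a = 0" | b where "a = osuc b" | "limit_ord a"
  unfolding limit_ord_def by blast

lemma not_limit_ord [simp]: "\<not> limit_ord 0" "\<not> limit_ord (osuc a)"
  by (auto simp: limit_ord_def)

lemma osup_upper:
  assumes "countable A" "a \<in> A"
  shows "a \<le> osup A"
proof -
  obtain b where "\<forall>a\<in>A. a \<le> b"
    using countable_bounded_omega1[OF assms(1)] less_imp_le by blast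
  then have "\<forall>a\<in>A. a \<le> osup A" unfolding osup_def by (rule LeastI)
  then show ?thesis using assms(2) by blast
qed

lemma osup_least: "(\<And>a. a \<in> A \<Longrightarrow> a \<le> b) \<Longrightarrow> osup A \<le> b"
  unfolding osup_def by (rule Least_le) blast

lemma wf_less_omega1: "wf {(a, b :: omega1). a < b}"
  by (rule wf)

lemma infinite_lessThan_omega: "infinite {..<omega}"
proof -
  obtain A :: "omega1 set" where A: "countable A" "infinite A"
    using uncountable_infinite[OF uncountable_UNIV_omega1] infinite_countable_subset'
    by (metis)
  obtain b where "\<forall>a\<in>A. a < b" using countable_bounded_omega1[OF A(1)] by blast
  then have "infinite {..<b}"
    using A(2) by (meson finite_subset lessThan_iff subsetI)
  then show ?thesis unfolding omega_def by (rule LeastI)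
qed

function ord_add :: "omega1 \<Rightarrow> omega1 \<Rightarrow> omega1" where
  "ord_add a 0 = a"
| "ord_add a (osuc b) = osuc (ord_add a b)"
| "limit_ord b \<Longrightarrow> ord_add a b = osup ((\<lambda>c. ord_add a c) ` {..<b})"
  by (auto elim: omega1_cases) (metis omega1_cases surj_pair)
termination
  by (relation "inv_image {(a, b). a < b} snd") (auto simp: wf_less_omega1)

function ord_mult :: "omega1 \<Rightarrow> omega1 \<Rightarrow> omega1" where
  "ord_mult a 0 = 0"
| "ord_mult a (osuc b) = ord_add (ord_mult a b) a"
| "limit_ord b \<Longrightarrow> ord_mult a b = osup ((\<lambda>c. ord_mult a c) ` {..<b})"
  by (auto elim: omega1_cases) (metis omega1_cases surj_pair)
termination
  by (relation "inv_image {(a, b). a < b} snd") (auto simp: wf_less_omega1)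

text \<open>Ordinal exponentiation with base \<open>\<omega>\<close>: \<open>omega_pow a\<close> is \<open>\<omega>\<^sup>a\<close>.\<close>

function omega_pow :: "omega1 \<Rightarrow> omega1" where
  "omega_pow 0 = 1"
| "omega_pow (osuc b) = ord_mult (omega_pow b) omega"
| "limit_ord b \<Longrightarrow> omega_pow b = osup (omega_pow ` {..<b})"
  by (auto elim: omega1_cases) (metis omega1_cases)
termination
  by (relation "{(a, b). a < b}") (auto simp: wf_less_omega1)

definition order_topology_on :: "'a::linorder set \<Rightarrow> 'a topology"
  where "order_topology_on S =
    topology_generated_by
      ({S} \<union> {{x\<in>S. x < a} | a. a \<in> S} \<union> {{x\<in>S. a < x} | a. a \<in> S})"

definition omega_interval :: "omega1 \<Rightarrow> omega1 topology"
  where "omega_interval d = order_topology_on {1..omega_pow d}"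

lemma topspace_order_topology_on [simp]: "topspace (order_topology_on S) = S"
  by (auto simp: order_topology_on_def)


section \<open>Cantor--Bendixson derivatives\<close>

definition nonisolated_points :: "'a topology \<Rightarrow> 'a set"
  where "nonisolated_points X = {x \<in> topspace X. \<not> openin X {x}}"

function cb_derivative :: "'a topology \<Rightarrow> omega1 \<Rightarrow> 'a set" where
  "cb_derivative X 0 = topspace X"
| "cb_derivative X (osuc d) = nonisolated_points (subtopology X (cb_derivative X d))"
| "limit_ord d \<Longrightarrow> cb_derivative X d = (\<Inter>e\<in>{..<d}. cb_derivative X e)"
  by (auto elim: omega1_cases) (metis omega1_cases surj_pair)
termination
  by (relation "inv_image {(a, b). a < b} snd") (auto simp: wf_less_omega1)


section \<open>Spaces of continuous functions and stable phase retrieval\<close>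

text \<open>A continuous function on \<open>X\<close> is represented by its extension by \<open>0\<close> outside \<open>topspace X\<close>, so
  that equality of functions is equality on \<open>X\<close> and the linear operations are pointwise.\<close>

definition cfun_space :: "'a topology \<Rightarrow> ('a \<Rightarrow> complex) set"
  where "cfun_space X =
    {f. continuous_map X euclidean f \<and> (\<forall>x. x \<notin> topspace X \<longrightarrow> f x = 0)}"

text \<open>Only used for bounded functions on nonempty spaces.\<close>

definition sup_norm :: "'a topology \<Rightarrow> ('a \<Rightarrow> 'b::real_normed_vector) \<Rightarrow> real"
  where "sup_norm X f = (SUP x\<in>topspace X. norm (f x))"

definition csubspace_of :: "'a topology \<Rightarrow> ('a \<Rightarrow> complex) set \<Rightarrow> bool"
  where "csubspace_of X E \<longleftrightarrow>
    E \<subseteq> cfun_space X \<and> (\<lambda>x. 0) \<in> E \<and>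
    (\<forall>f\<in>E. \<forall>g\<in>E. (\<lambda>x. f x + g x) \<in> E) \<and>
    (\<forall>c. \<forall>f\<in>E. (\<lambda>x. c * f x) \<in> E)"

definition does_stable_phase_retrieval ::
    "real \<Rightarrow> 'a topology \<Rightarrow> ('a \<Rightarrow> complex) set \<Rightarrow> bool"
  where "does_stable_phase_retrieval C X E \<longleftrightarrow>
    csubspace_of X E \<and>
    (\<forall>f\<in>E. \<forall>g\<in>E.
      (INF l\<in>{l. cmod l = 1}. sup_norm X (\<lambda>x. f x - l * g x))
        \<le> C * sup_norm X (\<lambda>x. cmod (f x) - cmod (g x)))"

definition does_SPR :: "'a topology \<Rightarrow> ('a \<Rightarrow> complex) set \<Rightarrow> bool"
  where "does_SPR X E \<longleftrightarrow> (\<exists>C\<ge>1. does_stable_phase_retrieval C X E)"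

definition clinear_map ::
    "'a topology \<Rightarrow> 'b topology \<Rightarrow> (('a \<Rightarrow> complex) \<Rightarrow> ('b \<Rightarrow> complex)) \<Rightarrow> bool"
  where "clinear_map X Y T \<longleftrightarrow>
    T ` cfun_space X \<subseteq> cfun_space Y \<and>
    (\<forall>f\<in>cfun_space X. \<forall>g\<in>cfun_space X. T (\<lambda>x. f x + g x) = (\<lambda>y. T f y + T g y)) \<and>
    (\<forall>c. \<forall>f\<in>cfun_space X. T (\<lambda>x. c * f x) = (\<lambda>y. c * T f y))"

definition isometric_embedding ::
    "'a topology \<Rightarrow> 'b topology \<Rightarrow> (('a \<Rightarrow> complex) \<Rightarrow> ('b \<Rightarrow> complex)) \<Rightarrow> bool"
  where "isometric_embedding X Y T \<longleftrightarrow>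
    clinear_map X Y T \<and> (\<forall>f\<in>cfun_space X. sup_norm Y (T f) = sup_norm X f)"

text \<open>Isomorphisms are those of Banach spaces: injective, bounded, with bounded inverse on the
  range.\<close>

definition isomorphic_embedding ::
    "'a topology \<Rightarrow> 'b topology \<Rightarrow> (('a \<Rightarrow> complex) \<Rightarrow> ('b \<Rightarrow> complex)) \<Rightarrow> bool"
  where "isomorphic_embedding X Y T \<longleftrightarrow>
    clinear_map X Y T \<and> inj_on T (cfun_space X) \<and>
    (\<exists>M. \<forall>f\<in>cfun_space X. sup_norm Y (T f) \<le> M * sup_norm X f) \<and>
    (\<exists>M. \<forall>f\<in>cfun_space X. sup_norm X f \<le> M * sup_norm Y (T f))"

text \<open>\<open>C(K)\<close> contains an isometric (resp. isomorphic) SPR copy of \<open>C(L)\<close>.\<close>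

definition contains_isometric_SPR_copy :: "'k topology \<Rightarrow> 'l topology \<Rightarrow> bool"
  where "contains_isometric_SPR_copy K L \<longleftrightarrow>
    (\<exists>T. isometric_embedding L K T \<and> does_SPR K (T ` cfun_space L))"

definition contains_isomorphic_SPR_copy :: "'k topology \<Rightarrow> 'l topology \<Rightarrow> bool"
  where "contains_isomorphic_SPR_copy K L \<longleftrightarrow>
    (\<exists>T. isomorphic_embedding L K T \<and> does_SPR K (T ` cfun_space L))"

end

theory Submission
  imports Defs
begin

text \<open>
  Let \<open>A\<close> be a set of functionals on \<open>E = C(L)\<close> whose supremum is an equivalent norm. The moduli
  \<open>|a f + c b f|\<close> with \<open>a, b \<in> A\<close> and \<open>c \<in> {1, \<i>}\<close> determine all products \<open>a f * cnj (b f)\<close>, and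
  taking for \<open>a\<close> a functional that nearly attains the norm of \<open>f\<close> recovers \<open>f\<close> stably up to a unimodular
  factor. So it suffices to realize all functionals \<open>(a + c b) / 2\<close> as point evaluations of a
  linear map \<open>T : E \<rightarrow> C(K)\<close> that does not increase the supremum over \<open>A\<close>.

  Such a \<open>T\<close> exists near a point of \<open>K\<^sup>(\<^sup>r\<^sup>)\<close> if the functionals form a system of
  Cantor--Bendixson rank \<open>r\<close>: take Urysohn functions on nested, disjoint open sets of \<open>K\<close>. Pairs from
  systems of ranks \<open>r\<close> and \<open>s\<close> form a system whose rank is the natural sum of \<open>r\<close> and \<open>s\<close>. For the
  isometric copies \<open>A\<close> consists of the evaluations at the points of \<open>[1, \<omega>\<^sup>\<gamma>]\<close>; the natural sum of \<open>\<gamma>\<close>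
  with itself is below \<open>\<omega>\<^sup>\<beta>\<close>. For the isomorphic copy the Bessaga--Pelczynski argument replaces the
  evaluations by differences of evaluations, which form a system of rank \<open>\<omega>\<^sup>\<beta>\<close> with top \<open>0\<close>; pairs of
  them have rank \<open>\<omega>\<^sup>\<beta> \<cdot> 2\<close>, and since the systems for \<open>c = 1\<close> and \<open>c = \<i>\<close> have the same top, one point
  of \<open>K\<^sup>(\<^sup>r\<^sup>)\<close> with \<open>r = \<omega>\<^sup>\<beta> \<cdot> 2\<close> is enough.
\<close>

section \<open>Ordinal arithmetic\<close>

lemma not_less_zero_omega1 [simp]: "\<not> a < (0 :: omega1)"
  by (simp add: not_less)

lemma osuc_le_iff: "osuc b \<le> c \<longleftrightarrow> b < c"
  by (metis less_osuc_iff not_le)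

lemma limit_ord_osuc_less: "limit_ord c \<Longrightarrow> b < c \<Longrightarrow> osuc b < c"
  by (metis limit_ord_def osuc_le_iff order_le_less)

lemma limit_ord_pos: "limit_ord c \<Longrightarrow> 0 < c"
  by (metis not_limit_ord(1) zero_le_omega1 order_le_less)

lemma less_one_omega1_iff [simp]: "a < (1 :: omega1) \<longleftrightarrow> a = 0"
  by (metis less_osuc_iff osuc_zero zero_le_omega1 order.antisym order.refl)

lemma one_le_omega1_iff: "1 \<le> (a :: omega1) \<longleftrightarrow> 0 < a"
  by (metis less_one_omega1_iff not_less zero_le_omega1 order_le_less)

lemma less_osup_D: "c < osup A \<Longrightarrow> \<exists>a\<in>A. c < a"
  by (metis not_le osup_least)

lemma le_osup_image_lessThan:
  fixes f :: "omega1 \<Rightarrow> omega1"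
  shows "a < b \<Longrightarrow> f a \<le> osup (f ` {..<b})"
  by (rule osup_upper) (auto simp: countable_lessThan_omega1)

lemma ord_add_strict_mono: "y < z \<Longrightarrow> ord_add x y < ord_add x z"
proof (induction z rule: less_induct)
  case (less z)
  show ?case
  proof (cases z rule: omega1_cases)
    case 1
    then show ?thesis using less.prems by simp
  next
    case (2 b)
    then show ?thesis using less by (cases "y = b") (auto simp: less_imp_le order_le_less)
  next
    case 3
    have "ord_add x y < ord_add x (osuc y)" by (simp add: less_osuc)
    also have "\<dots> \<le> ord_add x z"
      using le_osup_image_lessThan[of "osuc y" z "ord_add x"] limit_ord_osuc_less 3 less.prems
      by simp
    finally show ?thesis .
  qed
qed

lemma ord_add_mono: "y \<le> z \<Longrightarrow> ord_add x y \<le> ord_add x z"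
  by (metis ord_add_strict_mono order_le_less)

lemma ord_add_ge: "x \<le> ord_add x y"
  using ord_add_mono[of 0 y x] by simp

text \<open>One elimination rule for zero, successor and limit \<open>y\<close> alike. With
  \<open>omega1_le_lessI\<close> it reduces identities to a comparison of the ordinals below both
  sides, without cases on the form of \<open>y\<close>.\<close>

lemma ord_add_lessD: "c < ord_add x y \<Longrightarrow> c < x \<or> (\<exists>z<y. c \<le> ord_add x z)"
  by (cases y rule: omega1_cases) (auto intro: less_osuc less_imp_le dest!: less_osup_D)

lemma ord_add_lessD': "c < ord_add x y \<Longrightarrow> 0 < y \<Longrightarrow> \<exists>z<y. c \<le> ord_add x z"
  using ord_add_lessD[of c x y] by force

lemma omega1_le_lessI: "(\<And>c. c < u \<Longrightarrow> c < v) \<Longrightarrow> u \<le> (v :: omega1)"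
  by (meson less_irrefl not_le)

lemma ord_add_assoc: "ord_add x (ord_add y z) = ord_add (ord_add x y) z"
proof (induction z rule: less_induct)
  case (less z)
  show ?case
  proof (rule order.antisym; rule omega1_le_lessI)
    fix c assume "c < ord_add x (ord_add y z)"
    then consider "c < x" | w where "w < ord_add y z" "c \<le> ord_add x w"
      using ord_add_lessD by blast
    then show "c < ord_add (ord_add x y) z"
    proof cases
      case 1
      then show ?thesis by (meson less_le_trans ord_add_ge)
    next
      case (2 w)
      then consider "w < y" | v where "v < z" "w \<le> ord_add y v"
        using ord_add_lessD by blast
      then show ?thesis
      proof cases
        case 1
        then show ?thesis using 2 by (meson le_less_trans less_le_trans ord_add_ge ord_add_strict_mono)
      next
        case v: (2 v)
        have "c \<le> ord_add x (ord_add y v)"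
          using 2 v by (meson ord_add_mono order_trans)
        then show ?thesis
          using less[OF v(1)] ord_add_strict_mono[OF v(1)] by (metis le_less_trans)
      qed
    qed
  next
    fix c assume "c < ord_add (ord_add x y) z"
    then consider "c < ord_add x y" | w where "w < z" "c \<le> ord_add (ord_add x y) w"
      using ord_add_lessD by blast
    then show "c < ord_add x (ord_add y z)"
    proof cases
      case 1
      then show ?thesis by (meson less_le_trans ord_add_ge ord_add_mono)
    next
      case (2 w)
      then show ?thesis
        using less[OF 2(1)] ord_add_strict_mono by (metis le_less_trans)
    qed
  qed
qed

lemma ord_add_zero_left [simp]: "ord_add 0 y = y"
proof (induction y rule: less_induct)
  case (less y)
  show ?case
  proof (rule order.antisym; rule omega1_le_lessI)
    fix c assume "c < ord_add 0 y"
    then show "c < y" using ord_add_lessD[of c 0 y] less zero_le_omega1[of c]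
      by (metis le_less_trans not_le)
  next
    fix c assume "c < y"
    then show "c < ord_add 0 y"
      using less ord_add_strict_mono by metis
  qed
qed

lemma infinite_lessThan_limit_ord:
  assumes "limit_ord c"
  shows "infinite {..<c}"
proof
  assume fin: "finite {..<c}"
  have "{..<c} \<noteq> {}" using limit_ord_pos[OF assms] by auto
  then have "osuc (Max {..<c}) \<in> {..<c}"
    using limit_ord_osuc_less[OF assms] fin by (metis Max_in lessThan_iff)
  then have "osuc (Max {..<c}) \<le> Max {..<c}" using fin by simp
  then show False by (simp add: osuc_le_iff)
qed

lemma lessThan_osuc: "{..<osuc c} = insert c {..<c}"
  by auto

lemma limit_ord_omega: "limit_ord omega"
proof (cases omega rule: omega1_cases)
  case 1
  then have "{..<omega} = {}" by auto
  then show ?thesis using infinite_lessThan_omega by simp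
next
  case (2 b)
  then have "b < omega" using less_osuc[of b] by simp
  then have "finite {..<b}" unfolding omega_def using not_less_Least by blast
  then show ?thesis using infinite_lessThan_omega 2 by (metis finite_insert lessThan_osuc)
qed

lemma less_omega_imp_finite_ord: "c < omega \<Longrightarrow> \<exists>n. c = (osuc ^^ n) 0"
proof (induction c rule: less_induct)
  case (less c)
  show ?case
  proof (cases c rule: omega1_cases)
    case 1
    then show ?thesis by (intro exI[of _ 0]) simp
  next
    case (2 b)
    then have "b < c" using less_osuc[of b] by simp
    then obtain n where "b = (osuc ^^ n) 0" using less by fastforce
    then show ?thesis using 2 by (intro exI[of _ "Suc n"]) simp
  next
    case 3
    then have "infinite {..<c}" by (rule infinite_lessThan_limit_ord)
    then have "omega \<le> c" unfolding omega_def by (rule Least_le)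
    then show ?thesis using less by simp
  qed
qed

lemma finite_ord_less_omega: "(osuc ^^ n) 0 < omega"
  by (induction n) (auto simp: limit_ord_pos limit_ord_omega limit_ord_osuc_less)

section \<open>Finite multiples and powers of omega\<close>

definition ord_times_nat :: "omega1 \<Rightarrow> nat \<Rightarrow> omega1"
  where "ord_times_nat d n = ord_mult d ((osuc ^^ n) 0)"

lemma ord_times_nat_simps [simp]:
  "ord_times_nat d 0 = 0"
  "ord_times_nat d (Suc n) = ord_add (ord_times_nat d n) d"
  by (simp_all add: ord_times_nat_def)

lemma ord_times_nat_two: "ord_mult d (osuc 1) = ord_add d d"
  by (simp flip: osuc_zero)

lemma ord_times_nat_less_Suc: "0 < d \<Longrightarrow> ord_times_nat d n < ord_times_nat d (Suc n)"
  using ord_add_strict_mono[of 0 d] by simp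

lemma ord_times_nat_mono: "i \<le> j \<Longrightarrow> ord_times_nat d i \<le> ord_times_nat d j"
  by (rule lift_Suc_mono_le) (auto simp: ord_add_ge)

lemma less_ord_mult_omega_D: "c < ord_mult d omega \<Longrightarrow> \<exists>n. c < ord_times_nat d n"
  using less_omega_imp_finite_ord
  by (fastforce simp: limit_ord_omega ord_times_nat_def dest!: less_osup_D)

lemma ord_times_nat_less_ord_mult_omega:
  assumes "0 < d"
  shows "ord_times_nat d n < ord_mult d omega"
proof -
  have "ord_times_nat d (Suc n) \<le> ord_mult d omega"
    using le_osup_image_lessThan[OF finite_ord_less_omega, of "ord_mult d" "Suc n"]
    unfolding ord_times_nat_def by (simp add: limit_ord_omega)
  then show ?thesis using ord_times_nat_less_Suc[OF assms] less_le_trans by blast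
qed

lemma omega_pow_pos [simp]: "0 < omega_pow b"
proof (induction b rule: less_induct)
  case (less b)
  show ?case
  proof (cases b rule: omega1_cases)
    case 1
    then show ?thesis by (simp flip: one_le_omega1_iff)
  next
    case (2 c)
    then show ?thesis
      using less[of c] less_osuc[of c] ord_times_nat_less_ord_mult_omega[of "omega_pow c" 0] by simp
  next
    case 3
    have "omega_pow 0 \<le> omega_pow b"
      using le_osup_image_lessThan[of 0 b omega_pow] limit_ord_pos 3 by simp
    then show ?thesis by (simp add: one_le_omega1_iff)
  qed
qed

lemma omega_pow_less_osuc: "omega_pow b < omega_pow (osuc b)"
  using ord_times_nat_less_ord_mult_omega[of "omega_pow b" 1] by simp

lemma omega_pow_strict_mono: "b < c \<Longrightarrow> omega_pow b < omega_pow c"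
proof (induction c rule: less_induct)
  case (less c)
  show ?case
  proof (cases c rule: omega1_cases)
    case 1
    then show ?thesis using less.prems by simp
  next
    case (2 e)
    then have "b \<le> e" "e < c" using less.prems less_osuc by auto
    then have "omega_pow b \<le> omega_pow e" using less.IH[of e] by (auto simp: order_le_less)
    then show ?thesis using 2 omega_pow_less_osuc[of e] by (meson le_less_trans)
  next
    case 3
    have "omega_pow (osuc b) \<le> omega_pow c"
      using le_osup_image_lessThan[of "osuc b" c omega_pow] limit_ord_osuc_less 3 less.prems
      by simp
    then show ?thesis using omega_pow_less_osuc less_le_trans by blast
  qed
qed

lemma omega_pow_mono: "b \<le> c \<Longrightarrow> omega_pow b \<le> omega_pow c"
  by (metis omega_pow_strict_mono order_le_less)

lemma less_omega_pow_limit_D: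
  "limit_ord b \<Longrightarrow> c < omega_pow b \<Longrightarrow> \<exists>e<b. c < omega_pow e"
  by (auto dest!: less_osup_D)

text \<open>The natural (Hessenberg) sum.\<close>

function hsum :: "omega1 \<Rightarrow> omega1 \<Rightarrow> omega1" where
  "hsum a b = (LEAST c. \<forall>x\<in>(\<lambda>a'. hsum a' b) ` {..<a} \<union> (\<lambda>b'. hsum a b') ` {..<b}. x < c)"
  by auto
termination
  by (relation "{(a, b). a < b} <*lex*> {(a, b). a < b}") (auto simp: wf_less_omega1)

declare hsum.simps [simp del]

text \<open>The recursion takes the least strict upper bound of the earlier values. These are
  countably many, so a bound exists and the \<open>LEAST\<close> is meaningful.\<close>

lemma hsum_strict_mono: "a' < a \<Longrightarrow> hsum a' b < hsum a b" "b' < b \<Longrightarrow> hsum a b' < hsum a b"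
proof -
  let ?X = "(\<lambda>a'. hsum a' b) ` {..<a} \<union> (\<lambda>b'. hsum a b') ` {..<b}"
  have "\<exists>c. \<forall>x\<in>?X. x < c"
    by (rule countable_bounded_omega1) (auto simp: countable_lessThan_omega1)
  then have "\<forall>x\<in>?X. x < hsum a b"
    unfolding hsum.simps[of a b] by (rule LeastI_ex)
  then show "a' < a \<Longrightarrow> hsum a' b < hsum a b" "b' < b \<Longrightarrow> hsum a b' < hsum a b" by auto
qed

lemma hsum_least:
  assumes "\<And>a'. a' < a \<Longrightarrow> hsum a' b < c" "\<And>b'. b' < b \<Longrightarrow> hsum a b' < c"
  shows "hsum a b \<le> c"
  unfolding hsum.simps[of a b] by (rule Least_le) (use assms in auto)

lemma hsum_zero [simp]: "hsum 0 0 = 0"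
  using hsum_least[of 0 0 0] zero_le_omega1 by (metis not_le order.antisym)

text \<open>In a natural sum the multiples of \<open>d\<close> and the remainders below
  \<open>d\<close> add separately. In the induction on the pair, a smaller \<open>a\<close> or
  \<open>b\<close> lowers a remainder or a multiple; losing one \<open>d\<close> outweighs every
  natural sum of two remainders, since \<open>d\<close> is closed.\<close>

lemma hsum_times_nat_le:
  assumes closed: "\<And>a b. a < d \<Longrightarrow> b < d \<Longrightarrow> hsum a b < d" and "0 < d"
    and "a' < d" "b' < d"
    and "a \<le> ord_add (ord_times_nat d m) a'" "b \<le> ord_add (ord_times_nat d n) b'"
  shows "hsum a b \<le> ord_add (ord_times_nat d (m + n)) (hsum a' b')"
  using assms(3-)
proof (induction "(a, b)" arbitrary: a b m n a' b'
    rule: wf_induct_rule[OF wf_lex_prod[OF wf_less_omega1 wf_less_omega1]])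
  case (1 a b)
  have drop: "\<exists>k' x'. x' < d \<and> k' < k \<and> y \<le> ord_add (ord_times_nat d k') x'"
    if "y < ord_times_nat d k" for y k
  proof (cases k)
    case 0
    then show ?thesis using that by simp
  next
    case (Suc k')
    then show ?thesis using that ord_add_lessD'[of y "ord_times_nat d k'" d] \<open>0 < d\<close> by auto
  qed
  have lower: "ord_add (ord_times_nat d k') (hsum u v) < ord_add (ord_times_nat d k) w"
    if "k' < k" "u < d" "v < d" for k' k u v w
  proof -
    have "ord_add (ord_times_nat d k') (hsum u v) < ord_times_nat d (Suc k')"
      using ord_add_strict_mono closed that by simp
    also have "\<dots> \<le> ord_times_nat d k" using that by (intro ord_times_nat_mono) simp
    finally show ?thesis using ord_add_ge less_le_trans by blast
  qed
  show ?case
  proof (rule hsum_least)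
    fix y assume y: "y < a"
    then consider "y < ord_times_nat d m" | z where "z < a'" "y \<le> ord_add (ord_times_nat d m) z"
      using 1 ord_add_lessD by (meson less_le_trans)
    then show "hsum y b < ord_add (ord_times_nat d (m + n)) (hsum a' b')"
    proof cases
      case c1: 1
      then obtain k x where k: "x < d" "k < m" "y \<le> ord_add (ord_times_nat d k) x"
        using drop by blast
      have "hsum y b \<le> ord_add (ord_times_nat d (k + n)) (hsum x b')"
        by (rule 1(1)) (use y k 1 in auto)
      then show ?thesis using lower[of "k + n" "m + n" x b'] k 1 by (meson add_less_cancel_right le_less_trans)
    next
      case (2 z)
      have "hsum y b \<le> ord_add (ord_times_nat d (m + n)) (hsum z b')"
        by (rule 1(1)) (use y 2 1 in auto)
      then show ?thesis using hsum_strict_mono(1)[OF 2(1)] ord_add_strict_mono le_less_trans by blast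
    qed
  next
    fix y assume y: "y < b"
    then consider "y < ord_times_nat d n" | z where "z < b'" "y \<le> ord_add (ord_times_nat d n) z"
      using 1 ord_add_lessD by (meson less_le_trans)
    then show "hsum a y < ord_add (ord_times_nat d (m + n)) (hsum a' b')"
    proof cases
      case c1: 1
      then obtain k x where k: "x < d" "k < n" "y \<le> ord_add (ord_times_nat d k) x"
        using drop by blast
      have "hsum a y \<le> ord_add (ord_times_nat d (m + k)) (hsum a' x)"
        by (rule 1(1)) (use y k 1 in auto)
      then show ?thesis using lower[of "m + k" "m + n" a' x] k 1 by (meson add_less_cancel_left le_less_trans)
    next
      case (2 z)
      have "hsum a y \<le> ord_add (ord_times_nat d (m + n)) (hsum a' z)"
        by (rule 1(1)) (use y 2 1 in auto)
      then show ?thesis using hsum_strict_mono(2)[OF 2(1)] ord_add_strict_mono le_less_trans by blast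
    qed
  qed
qed

text \<open>At \<open>osuc e\<close> both summands lie below finite multiples of omega^e, and so
  does their natural sum; at a limit both lie below a common smaller power.\<close>

lemma hsum_less_omega_pow: "a < omega_pow g \<Longrightarrow> b < omega_pow g \<Longrightarrow> hsum a b < omega_pow g"
proof (induction g arbitrary: a b rule: less_induct)
  case (less g)
  show ?case
  proof (cases g rule: omega1_cases)
    case 1
    then show ?thesis using less.prems by simp
  next
    case (2 e)
    let ?d = "omega_pow e"
    have closed: "\<And>a b. a < ?d \<Longrightarrow> b < ?d \<Longrightarrow> hsum a b < ?d"
      using less.IH[of e] 2 less_osuc by simp
    obtain m n where mn: "a < ord_times_nat ?d m" "b < ord_times_nat ?d n"
      using less.prems 2 less_ord_mult_omega_D[of _ ?d] by (metis omega_pow.simps(2))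
    have "hsum a b \<le> ord_add (ord_times_nat ?d (m + n)) (hsum 0 0)"
      by (rule hsum_times_nat_le) (use closed mn in \<open>auto intro: less_imp_le\<close>)
    then show ?thesis
      using ord_times_nat_less_ord_mult_omega[of ?d "m + n"] 2 by (auto intro: le_less_trans)
  next
    case 3
    then obtain u v where uv: "u < g" "a < omega_pow u" "v < g" "b < omega_pow v"
      using less.prems less_omega_pow_limit_D by meson
    define w where "w = max u v"
    have "w < g" "a < omega_pow w" "b < omega_pow w"
      using uv omega_pow_mono[of u w] omega_pow_mono[of v w] by (auto simp: w_def intro: less_le_trans)
    then show ?thesis using less.IH omega_pow_strict_mono less_trans by blast
  qed
qed

lemma hsum_omega_pow_le: "hsum (omega_pow g) (omega_pow g) \<le> ord_add (omega_pow g) (omega_pow g)"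
  using hsum_times_nat_le[of "omega_pow g" 0 0 "omega_pow g" 1 "omega_pow g" 1]
  by (simp add: hsum_less_omega_pow)

section \<open>Systems of functionals\<close>

text \<open>A system of rank at most \<open>r\<close> with top \<open>m\<close>: the analogue, for functionals on \<open>E\<close> with
  pointwise convergence, of a countable compact space with \<open>r\<close>-th derivative contained in \<open>{m}\<close>.
  The members of \<open>P\<close> play the role of clopen sets accumulating only at \<open>m\<close>.\<close>

inductive cb_system ::
    "'f set \<Rightarrow> omega1 \<Rightarrow> ('f \<Rightarrow> complex) \<Rightarrow> ('f \<Rightarrow> complex) set \<Rightarrow> bool" for E where
  cb_systemI: "countable P \<Longrightarrow> (\<And>B. B \<in> P \<Longrightarrow> \<exists>s<r. \<exists>t. cb_system E s t B) \<Longrightarrow>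
    (\<And>f e. f \<in> E \<Longrightarrow> 0 < e \<Longrightarrow> finite {B\<in>P. \<exists>a\<in>B. e \<le> cmod (a f - m f)}) \<Longrightarrow>
    A = insert m (\<Union>P) \<Longrightarrow> cb_system E r m A"

lemma cb_systemD:
  assumes "cb_system E r m A"
  shows "\<exists>P. countable P \<and> (\<forall>B\<in>P. \<exists>s<r. \<exists>t. cb_system E s t B) \<and>
    (\<forall>f\<in>E. \<forall>e>0. finite {B\<in>P. \<exists>a\<in>B. e \<le> cmod (a f - m f)}) \<and> A = insert m (\<Union>P)"
  using assms
proof (cases rule: cb_system.cases)
  case (cb_systemI P)
  then show ?thesis by (intro exI[of _ P] conjI ballI allI impI) (assumption | rule cb_systemI)+
qed

lemma cb_system_top: "cb_system E r m A \<Longrightarrow> m \<in> A"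
  by (drule cb_systemD) auto

lemma cb_system_mono: "cb_system E r m A \<Longrightarrow> r \<le> s \<Longrightarrow> cb_system E s m A"
  by (drule cb_systemD, clarify, rule cb_systemI) (assumption | meson less_le_trans | blast | simp)+

lemma cb_system_singleton: "cb_system E r m {m}"
  by (rule cb_systemI[of "{}"]) auto

lemma cb_system_finite_pieces:
  assumes "finite P" "\<And>B. B \<in> P \<Longrightarrow> \<exists>s<r. \<exists>t. cb_system E s t B"
  shows "cb_system E r m (insert m (\<Union>P))"
  by (rule cb_systemI[of P]) (use assms in \<open>auto intro: countable_finite\<close>)

text \<open>Because the tops agree, the pieces can be pooled and the rank does not grow. This lets
  the pairs for \<open>c = 1\<close> and \<open>c = \<i>\<close> share one point of
  \<open>K\<close>.\<close>

lemma cb_system_union: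
  assumes "cb_system E r m A" "cb_system E r m B"
  shows "cb_system E r m (A \<union> B)"
proof -
  obtain P where P: "countable P" "\<forall>B\<in>P. \<exists>s<r. \<exists>t. cb_system E s t B"
    "\<forall>f\<in>E. \<forall>e>0. finite {B\<in>P. \<exists>a\<in>B. e \<le> cmod (a f - m f)}"
    "A = insert m (\<Union>P)" using cb_systemD[OF assms(1)] by blast
  obtain Q where Q: "countable Q" "\<forall>B\<in>Q. \<exists>s<r. \<exists>t. cb_system E s t B"
    "\<forall>f\<in>E. \<forall>e>0. finite {B\<in>Q. \<exists>a\<in>B. e \<le> cmod (a f - m f)}"
    "B = insert m (\<Union>Q)" using cb_systemD[OF assms(2)] by blast
  show ?thesis
  proof (rule cb_systemI[of "P \<union> Q"])
    fix f e assume *: "f \<in> E" "(0::real) < e"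
    show "finite {B\<in>P \<union> Q. \<exists>a\<in>B. e \<le> cmod (a f - m f)}"
      by (rule finite_subset[OF _ finite_UnI[OF P(3)[rule_format, OF *] Q(3)[rule_format, OF *]]]) blast
  qed (use P Q in auto)
qed

text \<open>Only the differences \<open>a f - m f\<close> enter the definition, and a translation
  does not change them. Used to measure functionals from a reference functional.\<close>

lemma cb_system_translate:
  assumes "cb_system E r m A"
  shows "cb_system E r (\<lambda>f. m f - n f) ((\<lambda>a f. a f - n f) ` A)"
  using assms
proof (induct rule: cb_system.induct)
  case (cb_systemI P r m A)
  let ?t = "\<lambda>a f. a f - n f"
  show ?case
  proof (rule cb_system.intros[of "(`) ?t ` P"])
    fix f e assume "f \<in> E" "(0::real) < e"
    then show "finite {B\<in>(`) ?t ` P. \<exists>a\<in>B. e \<le> cmod (a f - (m f - n f))}"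
      by (intro finite_subset[OF _ finite_imageI[OF cb_systemI(3)[of f e], of "(`) ?t"]])
        (auto intro!: imageI)
  next
    fix C assume "C \<in> (`) ?t ` P"
    then obtain B where "B \<in> P" "C = ?t ` B" by blast
    then show "\<exists>s<r. \<exists>t. cb_system E s t C" using cb_systemI(2)[of B] by metis
  qed (use cb_systemI in auto)
qed

text \<open>This replaces compactness: all but finitely many pieces stay within 1 of
  \<open>m\<close> at \<open>f\<close>, and the others are bounded by induction.\<close>

lemma cb_system_bounded:
  assumes "cb_system E r m A" "f \<in> E"
  shows "\<exists>b. \<forall>a\<in>A. cmod (a f) \<le> b"
  using assms(1)
proof (induct rule: cb_system.induct)
  case (cb_systemI P r m A)
  let ?Q = "{B\<in>P. \<exists>a\<in>B. 1 \<le> cmod (a f - m f)}"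
  have "\<forall>B\<in>P. \<exists>b. \<forall>a\<in>B. cmod (a f) \<le> b" using cb_systemI(2) by blast
  then obtain b where b: "\<And>B a. B \<in> P \<Longrightarrow> a \<in> B \<Longrightarrow> cmod (a f) \<le> b B" by metis
  have fin: "finite ?Q" using cb_systemI(3)[of f 1] assms(2) by simp
  show ?case
  proof (intro exI[of _ "Max (insert (cmod (m f) + 1) (b ` ?Q))"] ballI)
    fix a assume "a \<in> A"
    then consider "a = m" | B where "B \<in> P" "a \<in> B" "B \<in> ?Q" | B where "B \<in> P" "a \<in> B" "B \<notin> ?Q"
      using cb_systemI(4) by blast
    then show "cmod (a f) \<le> Max (insert (cmod (m f) + 1) (b ` ?Q))"
    proof cases
      case 2
      then have "cmod (a f) \<le> b B" using b by blast
      also have "\<dots> \<le> Max (insert (cmod (m f) + 1) (b ` ?Q))"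
        using 2 fin by (intro Max_ge) auto
      finally show ?thesis .
    next
      case 3
      then have "cmod (a f - m f) < 1" by force
      then have "cmod (a f) \<le> cmod (m f) + 1" using norm_triangle_ineq2[of "a f" "m f"] by linarith
      also have "\<dots> \<le> Max (insert (cmod (m f) + 1) (b ` ?Q))"
        using fin by (intro Max_ge) auto
      finally show ?thesis .
    qed (use fin in \<open>simp add: Max_ge_iff\<close>)
  qed
qed

text \<open>The factor 1/2 keeps \<open>mix c a b\<close> within the common bound of
  \<open>a\<close> and \<open>b\<close> when \<open>c\<close> is unimodular, and makes
  \<open>mix 1 a a = a\<close>.\<close>

definition mix :: "complex \<Rightarrow> ('f \<Rightarrow> complex) \<Rightarrow> ('f \<Rightarrow> complex) \<Rightarrow> 'f \<Rightarrow> complex"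
  where "mix c a b f = (a f + c * b f) / 2"

definition mixes :: "complex \<Rightarrow> ('f \<Rightarrow> complex) set \<Rightarrow> ('f \<Rightarrow> complex) set \<Rightarrow> ('f \<Rightarrow> complex) set"
  where "mixes c A B = {mix c a b |a b. a \<in> A \<and> b \<in> B}"

lemma mixes_mono: "A \<subseteq> A' \<Longrightarrow> B \<subseteq> B' \<Longrightarrow> mixes c A B \<subseteq> mixes c A' B'"
  by (auto simp: mixes_def)

lemma cmod_mix_diff_less:
  assumes "cmod c = 1" "cmod (a f - m f) < e" "cmod (b f - n f) < e"
  shows "cmod (mix c a b f - mix c m n f) < e"
proof -
  have "mix c a b f - mix c m n f = ((a f - m f) + c * (b f - n f)) / 2"
    by (simp add: mix_def field_simps)
  also have "cmod \<dots> \<le> (cmod (a f - m f) + cmod (c * (b f - n f))) / 2"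
    by (simp add: norm_divide divide_right_mono norm_triangle_ineq)
  also have "\<dots> < e" using assms by (simp add: norm_mult)
  finally show ?thesis .
qed

text \<open>A punctured neighbourhood of the top \<open>(m, n)\<close> of a product is cut into the pieces \<open>B \<times> C\<close>,
  where \<open>B\<close> is the \<open>k\<close>-th piece of one factor and \<open>C\<close> the other factor without its first \<open>k\<close>
  pieces. This makes the pieces converge to the top, which the products of pieces do not.\<close>

lemma cb_system_mixes:
  assumes c: "cmod c = 1"
  shows "cb_system E r m A \<Longrightarrow> cb_system E s n B \<Longrightarrow>
    cb_system E (hsum r s) (mix c m n) (mixes c A B)"
proof (induction "(r, s)" arbitrary: r s m n A B
    rule: wf_induct_rule[OF wf_lex_prod[OF wf_less_omega1 wf_less_omega1]])
  case (1 r s)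
  obtain P where P: "countable P" "\<forall>B\<in>P. \<exists>s<r. \<exists>t. cb_system E s t B"
    "\<forall>f\<in>E. \<forall>e>0. finite {B\<in>P. \<exists>a\<in>B. e \<le> cmod (a f - m f)}"
    "A = insert m (\<Union>P)" using cb_systemD[OF 1(2)] by blast
  obtain Q where Q: "countable Q" "\<forall>B\<in>Q. \<exists>r<s. \<exists>t. cb_system E r t B"
    "\<forall>f\<in>E. \<forall>e>0. finite {B\<in>Q. \<exists>a\<in>B. e \<le> cmod (a f - n f)}"
    "B = insert n (\<Union>Q)" using cb_systemD[OF 1(3)] by blast
  \<comment> \<open>The numberings fix which pieces come first; the tails \<open>PT k\<close> and
    \<open>QT k\<close> keep tops and ranks.\<close>
  define i where "i = to_nat_on P"
  define j where "j = to_nat_on Q"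
  have i: "inj_on i P" and j: "inj_on j Q"
    using P(1) Q(1) by (auto simp: i_def j_def)
  define PT where "PT k = {X\<in>P. k \<le> i X}" for k
  define QT where "QT k = {X\<in>Q. k \<le> j X}" for k
  have PT: "cb_system E r m (insert m (\<Union>(PT k)))" for k
  proof (rule cb_systemI[of "PT k"])
    fix f e assume *: "f \<in> E" "(0::real) < e"
    show "finite {B\<in>PT k. \<exists>a\<in>B. e \<le> cmod (a f - m f)}"
      by (rule finite_subset[OF _ P(3)[rule_format, OF *]]) (auto simp: PT_def)
  qed (use P in \<open>auto simp: PT_def\<close>)
  have QT: "cb_system E s n (insert n (\<Union>(QT k)))" for k
  proof (rule cb_systemI[of "QT k"])
    fix f e assume *: "f \<in> E" "(0::real) < e"
    show "finite {B\<in>QT k. \<exists>a\<in>B. e \<le> cmod (a f - n f)}"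
      by (rule finite_subset[OF _ Q(3)[rule_format, OF *]]) (auto simp: QT_def)
  qed (use Q in \<open>auto simp: QT_def\<close>)
  define F where "F X = mixes c X (insert n (\<Union>(QT (i X))))" for X
  define G where "G X = mixes c (insert m (\<Union>(PT (j X)))) X" for X
  show ?case
  proof (rule cb_systemI[of "F ` P \<union> G ` Q"])
    show "countable (F ` P \<union> G ` Q)" using P(1) Q(1) by auto
  next
    fix Y assume "Y \<in> F ` P \<union> G ` Q"
    then consider X where "X \<in> P" "Y = F X" | X where "X \<in> Q" "Y = G X" by blast
    then show "\<exists>u<hsum r s. \<exists>t. cb_system E u t Y"
    proof cases
      case X: 1
      then obtain u t where "u < r" "cb_system E u t X" using P(2) by blast
      then have "cb_system E (hsum u s) (mix c t n) (F X)"
        unfolding F_def by (intro 1(1)) (auto simp: QT)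
      then show ?thesis using X(2) hsum_strict_mono(1)[OF \<open>u < r\<close>] by metis
    next
      case X: 2
      then obtain u t where "u < s" "cb_system E u t X" using Q(2) by blast
      then have "cb_system E (hsum r u) (mix c m t) (G X)"
        unfolding G_def by (intro 1(1)) (auto simp: PT)
      then show ?thesis using X(2) hsum_strict_mono(2)[OF \<open>u < s\<close>] by metis
    qed
  next
    fix f e assume fe: "f \<in> E" "(0::real) < e"
    define P0 where "P0 = {B\<in>P. \<exists>a\<in>B. e \<le> cmod (a f - m f)}"
    define Q0 where "Q0 = {B\<in>Q. \<exists>a\<in>B. e \<le> cmod (a f - n f)}"
    have fin: "finite P0" "finite Q0" using P(3) Q(3) fe by (auto simp: P0_def Q0_def)
    then obtain b where b: "\<And>X. X \<in> P0 \<Longrightarrow> i X \<le> b" "\<And>X. X \<in> Q0 \<Longrightarrow> j X \<le> b"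
      using finite_nat_set_iff_bounded_le[of "i ` P0 \<union> j ` Q0"] by auto
    have far: "e \<le> cmod (a f - m f) \<or> e \<le> cmod (b f - n f)"
      if "e \<le> cmod (mix c a b f - mix c m n f)" for a b
      using cmod_mix_diff_less[OF c, of a f m e b n] that by linarith
    \<comment> \<open>A member of \<open>F X\<close> far from the top has a far component. If it is
      the first, \<open>X\<close> is in \<open>P0\<close>; otherwise the second lies in some
      \<open>Z\<close> in \<open>Q0\<close> from the tail, and \<open>i X <= j Z <= b\<close> leaves
      finitely many \<open>X\<close>.\<close>
    have nearP: "X \<in> P0 \<union> {X\<in>P. i X \<le> b}"
      if h1: "X \<in> P" and h2: "x \<in> F X" and h3: "e \<le> cmod (x f - mix c m n f)" for X x
    proof -
      obtain u v where uv: "u \<in> X" "v \<in> insert n (\<Union>(QT (i X)))" "x = mix c u v"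
        using h2 by (auto simp: F_def mixes_def)
      then consider "e \<le> cmod (u f - m f)" | "e \<le> cmod (v f - n f)" using far[of u v] h3 by blast
      then show ?thesis
      proof cases
        case 2
        then obtain Z where "Z \<in> QT (i X)" "v \<in> Z" using uv fe by auto
        then have "Z \<in> Q0" "i X \<le> j Z" using 2 by (auto simp: QT_def Q0_def)
        then show ?thesis using b(2) h1 by fastforce
      qed (use uv h1 in \<open>auto simp: P0_def\<close>)
    qed
    have nearQ: "X \<in> Q0 \<union> {X\<in>Q. j X \<le> b}"
      if h1: "X \<in> Q" and h2: "x \<in> G X" and h3: "e \<le> cmod (x f - mix c m n f)" for X x
    proof -
      obtain u v where uv: "v \<in> X" "u \<in> insert m (\<Union>(PT (j X)))" "x = mix c u v"
        using h2 by (auto simp: G_def mixes_def)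
      then consider "e \<le> cmod (u f - m f)" | "e \<le> cmod (v f - n f)" using far[of u v] h3 by blast
      then show ?thesis
      proof cases
        case 1
        then obtain Z where "Z \<in> PT (j X)" "u \<in> Z" using uv fe by auto
        then have "Z \<in> P0" "j X \<le> i Z" using 1 by (auto simp: PT_def P0_def)
        then show ?thesis using b(1) h1 by fastforce
      qed (use uv h1 in \<open>auto simp: Q0_def\<close>)
    qed
    let ?P1 = "P0 \<union> {X\<in>P. i X \<le> b}" and ?Q1 = "Q0 \<union> {X\<in>Q. j X \<le> b}"
    have "finite {X\<in>P. i X \<le> b}"
      by (rule inj_on_finite[of i _ "{..b}"]) (auto intro: inj_on_subset[OF i])
    moreover have "finite {X\<in>Q. j X \<le> b}"
      by (rule inj_on_finite[of j _ "{..b}"]) (auto intro: inj_on_subset[OF j])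
    ultimately have "finite (F ` ?P1 \<union> G ` ?Q1)" using fin by blast
    have near: "Y \<in> F ` ?P1 \<union> G ` ?Q1"
      if "Y \<in> F ` P \<union> G ` Q" and x: "x \<in> Y" "e \<le> cmod (x f - mix c m n f)" for Y x
      using that(1)
    proof
      assume "Y \<in> F ` P"
      then obtain X where X: "X \<in> P" "Y = F X" by blast
      then have "X \<in> ?P1" using x by (intro nearP[of X x]) simp_all
      then show ?thesis using X(2) by blast
    next
      assume "Y \<in> G ` Q"
      then obtain X where X: "X \<in> Q" "Y = G X" by blast
      then have "X \<in> ?Q1" using x by (intro nearQ[of X x]) simp_all
      then show ?thesis using X(2) by blast
    qed
    have "{Y \<in> F ` P \<union> G ` Q. \<exists>a\<in>Y. e \<le> cmod (a f - mix c m n f)}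
      \<subseteq> F ` ?P1 \<union> G ` ?Q1"
      using near by (intro subsetI, elim CollectE conjE bexE)
    then show "finite {Y \<in> F ` P \<union> G ` Q. \<exists>a\<in>Y. e \<le> cmod (a f - mix c m n f)}"
      using \<open>finite (F ` ?P1 \<union> G ` ?Q1)\<close> by (rule finite_subset)
  next
    \<comment> \<open>For \<open>a\<close> in \<open>X\<close> and \<open>b\<close> in
      \<open>Z\<close> the indices decide: \<open>i X <= j Z\<close> puts the pair into
      \<open>F X\<close>; otherwise \<open>X\<close> belongs to the tail \<open>PT (j Z)\<close>,
      and the pair is in \<open>G Z\<close>.\<close>
    have cover: "x \<in> insert (mix c m n) (\<Union>(F ` P \<union> G ` Q))" if x: "x \<in> mixes c A B" for x
    proof -
      obtain a b where ab: "a \<in> A" "b \<in> B" "x = mix c a b" using x by (auto simp: mixes_def)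
      show ?thesis
      proof (cases "\<exists>X\<in>P. a \<in> X \<and> b \<in> insert n (\<Union>(QT (i X)))")
        case True
        then show ?thesis using ab by (auto simp: F_def mixes_def)
      next
        case False
        show ?thesis
        proof (cases "b \<in> \<Union>Q")
          case True
          then obtain Z where Z: "Z \<in> Q" "b \<in> Z" by blast
          have "a \<in> insert m (\<Union>(PT (j Z)))"
          proof (cases "a = m")
            case False
            then obtain X where X: "X \<in> P" "a \<in> X" using ab P(4) by blast
            then have "\<not> i X \<le> j Z" using \<open>\<not> (\<exists>X\<in>P. _ X)\<close> Z by (auto simp: QT_def)
            then show ?thesis using X by (auto simp: PT_def)
          qed simp
          then have "x \<in> G Z" using Z ab by (auto simp: G_def mixes_def)
          then show ?thesis using Z by blast
        next
          case b: False
          then have "b = n" "a \<notin> \<Union>P" using ab Q(4) False by auto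
          then show ?thesis using ab P(4) by auto
        qed
      qed
    qed
    have F: "F X \<subseteq> mixes c A B" if "X \<in> P" for X
      using that unfolding F_def by (intro mixes_mono) (auto simp: P(4) Q(4) QT_def)
    have G: "G X \<subseteq> mixes c A B" if "X \<in> Q" for X
      using that unfolding G_def by (intro mixes_mono) (auto simp: P(4) Q(4) PT_def)
    have top: "mix c m n \<in> mixes c A B"
      using P(4) Q(4) by (auto simp: mixes_def)
    have "insert (mix c m n) (\<Union>(F ` P \<union> G ` Q)) \<subseteq> mixes c A B"
      unfolding insert_subset using top F G by (intro conjI Union_least) auto
    then show "mixes c A B = insert (mix c m n) (\<Union>(F ` P \<union> G ` Q))"
      by (intro equalityI subsetI[OF cover])
  qed
qed

section \<open>Differences of functionals\<close>

text \<open>\<open>A0\<close> is the coarse part of \<open>A\<close>, the points of rank at least \<open>d\<close>; a pair \<open>(B, b)\<close> in \<open>R\<close> is a block \<open>B\<close>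
  of rank below \<open>d\<close> together with the coarse point \<open>b\<close> near which it lies.\<close>

definition splitting where
  "splitting E d A A0 R \<longleftrightarrow> A0 \<subseteq> A \<and> countable R \<and> A \<subseteq> A0 \<union> (\<Union>p\<in>R. fst p) \<and>
    (\<forall>p\<in>R. snd p \<in> A0 \<and> fst p \<subseteq> A \<and> (\<exists>s<d. \<exists>t. cb_system E s t (fst p))) \<and>
    (\<forall>f\<in>E. \<forall>e>0. finite {p\<in>R. \<exists>a\<in>fst p. e \<le> cmod (a f - snd p f)})"

text \<open>Pieces of rank below \<open>d\<close> become blocks attached to \<open>m\<close>. Every
  other piece has rank at most d + v with v < u and splits by induction; the resulting coarse parts
  are the pieces of the new coarse system.\<close>

lemma cb_system_split:
  "cb_system E r m A \<Longrightarrow> r \<le> ord_add d u \<Longrightarrow> \<exists>A0 R. cb_system E u m A0 \<and> splitting E d A A0 R"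
proof (induction u arbitrary: r m A rule: less_induct)
  case (less u)
  obtain P where P: "countable P" "\<forall>B\<in>P. \<exists>s<r. \<exists>t. cb_system E s t B"
    "\<forall>f\<in>E. \<forall>e>0. finite {B\<in>P. \<exists>a\<in>B. e \<le> cmod (a f - m f)}"
    "A = insert m (\<Union>P)" using cb_systemD[OF less.prems(1)] by blast
  define P1 where "P1 = {B\<in>P. \<exists>s<d. \<exists>t. cb_system E s t B}"
  have "\<exists>A0 R. (\<exists>v<u. \<exists>t. cb_system E v t A0) \<and> splitting E d B A0 R" if B: "B \<in> P - P1" for B
  proof -
    obtain s t where s: "s < r" "cb_system E s t B" using B P(2) by blast
    then have "\<not> s < d" using B by (auto simp: P1_def)
    then obtain v where "v < u" "s \<le> ord_add d v"
      using ord_add_lessD[of s d u] s less.prems(2) by (meson less_le_trans)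
    then show ?thesis using less.IH s by meson
  qed
  then obtain A0 R where AR: "\<And>B. B \<in> P - P1 \<Longrightarrow> \<exists>v<u. \<exists>t. cb_system E v t (A0 B)"
    "\<And>B. B \<in> P - P1 \<Longrightarrow> splitting E d B (A0 B) (R B)"
    by metis
  define A0' where "A0' = insert m (\<Union>(A0 ` (P - P1)))"
  define R' where "R' = (\<lambda>B. (B, m)) ` P1 \<union> (\<Union>B\<in>P - P1. R B)"
  note spl = AR(2)[unfolded splitting_def]
  have "cb_system E u m A0'"
  proof (rule cb_systemI[of "A0 ` (P - P1)"])
    fix f e assume fe: "f \<in> E" "(0::real) < e"
    have "{B \<in> A0 ` (P - P1). \<exists>a\<in>B. e \<le> cmod (a f - m f)}
        \<subseteq> A0 ` {B\<in>P. \<exists>a\<in>B. e \<le> cmod (a f - m f)}"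
      using spl by blast
    then show "finite {B \<in> A0 ` (P - P1). \<exists>a\<in>B. e \<le> cmod (a f - m f)}"
      using P(3) fe by (meson finite_imageI finite_subset)
  next
    fix B assume "B \<in> A0 ` (P - P1)"
    then show "\<exists>s<u. \<exists>t. cb_system E s t B" using AR(1) by blast
  qed (use P(1) in \<open>auto simp: A0'_def\<close>)
  moreover have "splitting E d A A0' R'"
    unfolding splitting_def
  proof (intro conjI ballI allI impI)
    show "A0' \<subseteq> A" using spl P(4) by (fastforce simp: A0'_def)
    have "countable (\<Union>B\<in>P - P1. R B)" using spl P(1) by (intro countable_UN) auto
    moreover have "countable P1" using P(1) by (rule countable_subset[rotated]) (auto simp: P1_def)
    ultimately show "countable R'" by (simp add: R'_def)
    have "a \<in> A0' \<union> (\<Union>p\<in>R'. fst p)" if a: "a \<in> A" for a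
    proof (cases "a = m")
      case False
      then obtain B where B: "B \<in> P" "a \<in> B" using a P(4) by blast
      show ?thesis
      proof (cases "B \<in> P1")
        case True
        then show ?thesis using B by (auto simp: R'_def)
      next
        case False
        then have "a \<in> A0 B \<union> (\<Union>p\<in>R B. fst p)" using spl[of B] B by blast
        then show ?thesis using B False by (auto simp: A0'_def R'_def)
      qed
    qed (simp add: A0'_def)
    then show "A \<subseteq> A0' \<union> (\<Union>p\<in>R'. fst p)" by blast
  next
    fix p assume "p \<in> R'"
    then consider B where "B \<in> P1" "p = (B, m)" | B where "B \<in> P - P1" "p \<in> R B"
      by (auto simp: R'_def)
    note cases = this
    show "snd p \<in> A0'"
      using cases
    proof cases
      case (2 B)
      then have "snd p \<in> A0 B" using spl[of B] by blast
      then show ?thesis using 2 by (auto simp: A0'_def)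
    qed (simp add: A0'_def)
    show "fst p \<subseteq> A"
      using cases
    proof cases
      case (2 B)
      then have "fst p \<subseteq> B" using spl[of B] by blast
      then show ?thesis using 2 P(4) by blast
    qed (use P(4) in \<open>auto simp: P1_def\<close>)
    show "\<exists>s<d. \<exists>t. cb_system E s t (fst p)"
      using cases
    proof cases
      case (2 B)
      then show ?thesis using spl[of B] by blast
    qed (auto simp: P1_def)
  next
    fix f e assume fe: "f \<in> E" "(0::real) < e"
    \<comment> \<open>If a member of a block cut from a piece \<open>B\<close> is \<open>e\<close>
      away from its coarse point, then it or the coarse point lies in \<open>B\<close> and is
      \<open>e / 2\<close> away from \<open>m\<close>. So the violating blocks come from the
      finitely many pieces in \<open>bad\<close>.\<close>
    define bad where "bad = {B\<in>P. \<exists>a\<in>B. e / 2 \<le> cmod (a f - m f)}"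
    have "finite bad" unfolding bad_def
      by (rule P(3)[rule_format]) (use fe in auto)
    let ?U = "(\<lambda>B. (B, m)) ` bad \<union>
      (\<Union>B\<in>bad - P1. {p\<in>R B. \<exists>a\<in>fst p. e \<le> cmod (a f - snd p f)})"
    have "p \<in> ?U" if p: "p \<in> R'" and a: "a \<in> fst p" "e \<le> cmod (a f - snd p f)" for p a
    proof -
      consider B where "B \<in> P1" "p = (B, m)" | B where "B \<in> P - P1" "p \<in> R B"
        using p by (auto simp: R'_def)
      then show ?thesis
      proof cases
        case (1 B)
        then have "B \<in> bad" using a fe unfolding bad_def P1_def
          by (auto intro!: bexI[of _ a])
        then show ?thesis using 1 by blast
      next
        case (2 B)
        then have "a \<in> B" "snd p \<in> B" using a(1) spl[of B] by blast+
        moreover have "e \<le> cmod (a f - m f) + cmod (snd p f - m f)"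
          using a(2) norm_triangle_ineq4[of "a f - m f" "snd p f - m f"] by simp
        then have "e / 2 \<le> cmod (a f - m f) \<or> e / 2 \<le> cmod (snd p f - m f)" by linarith
        ultimately have "B \<in> bad" using 2 unfolding bad_def by blast
        then show ?thesis using 2 a by blast
      qed
    qed
    then have sub: "{p \<in> R'. \<exists>a\<in>fst p. e \<le> cmod (a f - snd p f)} \<subseteq> ?U" by blast
    have "finite {p\<in>R B. \<exists>a\<in>fst p. e \<le> cmod (a f - snd p f)}" if "B \<in> bad - P1" for B
      using spl[of B] that fe by (auto simp: bad_def)
    then have "finite ?U" using \<open>finite bad\<close> by blast
    then show "finite {p \<in> R'. \<exists>a\<in>fst p. e \<le> cmod (a f - snd p f)}"
      using sub by (rule finite_subset[rotated])
  qed
  ultimately show ?case by blast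
qed

definition differences :: "('f \<Rightarrow> complex) set \<Rightarrow> ('f \<Rightarrow> complex) set"
  where "differences A = {(\<lambda>f. a f - b f) |a b. a \<in> A \<and> b \<in> A}"

lemma differencesI: "a \<in> A \<Longrightarrow> b \<in> A \<Longrightarrow> (\<lambda>f. a f - b f) \<in> differences A"
  by (auto simp: differences_def)

lemma zero_in_differences: "a \<in> A \<Longrightarrow> (\<lambda>f. 0) \<in> differences A"
  using differencesI[of a A a] by simp

lemma differences_mono: "A \<subseteq> B \<Longrightarrow> differences A \<subseteq> differences B"
  by (auto simp: differences_def)

text \<open>\<open>M\<close> is norming, up to the factor \<open>C\<close>, for the members of
  \<open>B\<close> measured from \<open>t\<close>. The bound \<open>k\<close> stands in for the
  supremum over \<open>M\<close>, which need not be formed.\<close>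

definition norms_differences where
  "norms_differences E C M t B \<longleftrightarrow>
    (\<forall>f\<in>E. \<forall>k. (\<forall>a\<in>M. cmod (a f) \<le> k) \<longrightarrow> (\<forall>a\<in>B. cmod (a f - t f) \<le> C * k))"

text \<open>The nontrivial half of the Bessaga--Pelczynski classification, \<open>C[1, \<omega>\<^sup>r] \<hookrightarrow> C[1, \<omega>\<^sup>d]\<close> for
  \<open>d = \<omega>\<^sup>b\<close> and \<open>r < d \<cdot> n\<close>. Instead of the values at the points of a block one takes their
  differences from the value at the next point of the coarser level; these tend to zero along
  the blocks, so the blocks can be put side by side.\<close>

lemma ex_cb_system_differences:
  assumes "0 < d"
  shows "\<exists>C\<ge>0. \<forall>r m A. r < ord_times_nat d n \<longrightarrow> cb_system E r m A \<longrightarrow>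
    (\<exists>M. cb_system E d (\<lambda>f. 0) M \<and> M \<subseteq> differences A \<and> norms_differences E C M m A)"
proof (induction n)
  case 0
  then show ?case by auto
next
  case (Suc n)
  then obtain C where C: "C \<ge> 0" and IH: "\<And>r m A. r < ord_times_nat d n \<Longrightarrow>
    cb_system E r m A \<Longrightarrow>
    \<exists>M. cb_system E d (\<lambda>f. 0) M \<and> M \<subseteq> differences A \<and> norms_differences E C M m A"
    by blast
  have "\<exists>M. cb_system E d (\<lambda>f. 0) M \<and> M \<subseteq> differences A \<and> norms_differences E (C + 2) M m A"
    if r: "r < ord_times_nat d (Suc n)" and A: "cb_system E r m A" for r m A
  proof -
    \<comment> \<open>The excess \<open>u\<close> of \<open>r\<close> over d * n can be taken below
      \<open>d\<close>: the coarse part then has rank \<open>u\<close>, and the blocks have rank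
      below d * n, within reach of the induction hypothesis.\<close>
    obtain u where u: "u < d" "r \<le> ord_add (ord_times_nat d n) u"
      using ord_add_lessD'[of r "ord_times_nat d n" d] r \<open>0 < d\<close> by auto
    obtain A0 R where A0: "cb_system E u m A0" and "splitting E (ord_times_nat d n) A A0 R"
      using cb_system_split[OF A u(2)] by blast
    then have R: "A0 \<subseteq> A" "countable R" "A \<subseteq> A0 \<union> (\<Union>p\<in>R. fst p)"
      "\<And>p. p \<in> R \<Longrightarrow> snd p \<in> A0" "\<And>p. p \<in> R \<Longrightarrow> fst p \<subseteq> A"
      "\<And>p. p \<in> R \<Longrightarrow> \<exists>s<ord_times_nat d n. \<exists>t. cb_system E s t (fst p)"
      "\<And>f e. f \<in> E \<Longrightarrow> 0 < e \<Longrightarrow> finite {p\<in>R. \<exists>a\<in>fst p. e \<le> cmod (a f - snd p f)}"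
      unfolding splitting_def by simp_all
    \<comment> \<open>The induction hypothesis for a block is recorded through the pieces
      \<open>P\<close> of its system with top 0, since these pieces are pooled over all
      blocks.\<close>
    define good where "good p t P \<longleftrightarrow> t \<in> fst p \<and> countable P \<and>
      (\<forall>B\<in>P. \<exists>s<d. \<exists>t. cb_system E s t B) \<and>
      (\<forall>f\<in>E. \<forall>e>0. finite {B\<in>P. \<exists>a\<in>B. e \<le> cmod (a f - 0)}) \<and>
      \<Union>P \<subseteq> differences (fst p) \<and> norms_differences E C (insert (\<lambda>f. 0) (\<Union>P)) t (fst p)"
      for p :: "('a \<Rightarrow> complex) set \<times> ('a \<Rightarrow> complex)" and t P
    have "\<exists>t P. good p t P" if p: "p \<in> R" for p
    proof -
      obtain s t where s: "s < ord_times_nat d n" "cb_system E s t (fst p)" using R(6) p by blast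
      obtain M where M: "cb_system E d (\<lambda>f. 0) M" "M \<subseteq> differences (fst p)"
        "norms_differences E C M t (fst p)" using IH[OF s] by blast
      obtain P where P: "countable P" "\<forall>B\<in>P. \<exists>s<d. \<exists>t. cb_system E s t B"
        "\<forall>f\<in>E. \<forall>e>0. finite {B\<in>P. \<exists>a\<in>B. e \<le> cmod (a f - 0)}"
        "M = insert (\<lambda>f. 0) (\<Union>P)" using cb_systemD[OF M(1)] by blast
      have "good p t P"
        unfolding good_def using P(1-3) M(2,3) P(4) cb_system_top[OF s(2)] by simp
      then show ?thesis by blast
    qed
    then obtain t P where "\<And>p. p \<in> R \<Longrightarrow> good p (t p) (P p)" by metis
    then have tP: "\<And>p. p \<in> R \<Longrightarrow> t p \<in> fst p" "\<And>p. p \<in> R \<Longrightarrow> countable (P p)"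
      "\<And>p B. p \<in> R \<Longrightarrow> B \<in> P p \<Longrightarrow> \<exists>s<d. \<exists>t. cb_system E s t B"
      "\<And>p f e. p \<in> R \<Longrightarrow> f \<in> E \<Longrightarrow> 0 < e \<Longrightarrow> finite {B\<in>P p. \<exists>a\<in>B. e \<le> cmod (a f)}"
      "\<And>p. p \<in> R \<Longrightarrow> \<Union>(P p) \<subseteq> differences (fst p)"
      "\<And>p. p \<in> R \<Longrightarrow> norms_differences E C (insert (\<lambda>f. 0) (\<Union>(P p))) (t p) (fst p)"
      by (simp_all add: good_def)
    \<comment> \<open>\<open>M\<close> holds three kinds of differences: coarse points against
      \<open>m\<close>, the top of a block against its coarse point, and differences within blocks.
      The first kind is a single piece of rank \<open>u\<close>; the others tend to zero along the
      blocks.\<close>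
    define link where "link p = (\<lambda>f. t p f - snd p f)" for p
    define core where "core = (\<lambda>a f. a f - m f) ` A0"
    define Q where "Q = insert core ((\<lambda>p. {link p}) ` R \<union> (\<Union>p\<in>R. P p))"
    define M where "M = insert (\<lambda>f. 0) (\<Union>Q)"
    have core_M: "core \<subseteq> M" and link_M: "\<And>p. p \<in> R \<Longrightarrow> link p \<in> M"
      and P_M: "\<And>p. p \<in> R \<Longrightarrow> insert (\<lambda>f. 0) (\<Union>(P p)) \<subseteq> M"
      by (auto simp: M_def Q_def)
    have "cb_system E d (\<lambda>f. 0) M"
    proof (rule cb_systemI[of Q])
      show "countable Q" using R(2) tP(2) by (auto simp: Q_def)
    next
      fix B assume "B \<in> Q"
      then consider "B = core" | p where "B = {link p}" | p where "p \<in> R" "B \<in> P p"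
        by (auto simp: Q_def)
      then show "\<exists>s<d. \<exists>t. cb_system E s t B"
      proof cases
        case 1
        then show ?thesis using cb_system_translate[OF A0, of m] u(1) unfolding core_def by blast
      next
        case 2
        then show ?thesis using cb_system_singleton \<open>0 < d\<close> by blast
      qed (rule tP(3))
    next
      fix f e assume fe: "f \<in> E" "(0::real) < e"
      define bad where "bad = {p\<in>R. \<exists>a\<in>fst p. e / 2 \<le> cmod (a f - snd p f)}"
      have "finite bad" unfolding bad_def by (rule R(7)) (use fe in auto)
      let ?U = "insert core ((\<lambda>p. {link p}) ` bad \<union> (\<Union>p\<in>bad. {B\<in>P p. \<exists>a\<in>B. e \<le> cmod (a f)}))"
      have "B \<in> ?U" if B: "B \<in> Q" and a: "a \<in> B" "e \<le> cmod (a f)" for B a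
      proof -
        consider "B = core" | p where "p \<in> R" "B = {link p}" | p where "p \<in> R" "B \<in> P p"
          using B by (auto simp: Q_def)
        then show ?thesis
        proof cases
          case (2 p)
          then have "e \<le> cmod (t p f - snd p f)" using a by (simp add: link_def)
          then have "p \<in> bad" using 2 tP(1)[of p] fe unfolding bad_def
            by (auto intro!: bexI[of _ "t p"])
          then show ?thesis using 2 by blast
        next
          case (3 p)
          then have "a \<in> differences (fst p)" using a tP(5) by blast
          then obtain x y where xy: "x \<in> fst p" "y \<in> fst p" "a f = x f - y f"
            by (auto simp: differences_def)
          then have "e \<le> cmod (x f - snd p f) + cmod (y f - snd p f)"
            using a(2) norm_triangle_ineq4[of "x f - snd p f" "y f - snd p f"] by simp
          then have "e / 2 \<le> cmod (x f - snd p f) \<or> e / 2 \<le> cmod (y f - snd p f)" by linarith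
          then have "p \<in> bad" using 3 xy unfolding bad_def by blast
          then show ?thesis using 3 a by blast
        qed simp
      qed
      then have sub: "{B \<in> Q. \<exists>a\<in>B. e \<le> cmod (a f - 0)} \<subseteq> ?U" by auto
      have "finite ?U" using \<open>finite bad\<close> tP(4) fe by (auto simp: bad_def)
      then show "finite {B \<in> Q. \<exists>a\<in>B. e \<le> cmod (a f - 0)}"
        using sub by (rule finite_subset[rotated])
    qed (simp add: M_def)
    moreover have "M \<subseteq> differences A"
    proof
      fix a assume "a \<in> M"
      then consider "a = (\<lambda>f. 0)" | "a \<in> core" | p where "p \<in> R" "a = link p"
        | p where "p \<in> R" "a \<in> \<Union>(P p)"
        unfolding M_def Q_def by blast
      then show "a \<in> differences A"
      proof cases
        case 1
        then show ?thesis using zero_in_differences[OF cb_system_top[OF A]] by simp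
      next
        case 2
        then show ?thesis using R(1) cb_system_top[OF A] by (auto simp: core_def intro!: differencesI)
      next
        case (3 p)
        then have "t p \<in> A" "snd p \<in> A" using R(1,4,5) tP(1) by blast+
        then show ?thesis using 3 by (simp add: link_def differencesI)
      next
        case (4 p)
        then show ?thesis using tP(5)[OF 4(1)] differences_mono[OF R(5)[OF 4(1)]] by blast
      qed
    qed
    moreover have "norms_differences E (C + 2) M m A"
      unfolding norms_differences_def
    proof (intro ballI allI impI)
      fix f k a assume f: "f \<in> E" and k: "\<forall>a\<in>M. cmod (a f) \<le> k" and a: "a \<in> A"
      have "0 \<le> k" using k by (force simp: M_def)
      have core: "cmod (b f - m f) \<le> k" if "b \<in> A0" for b
      proof -
        have "(\<lambda>f. b f - m f) \<in> M" using that core_M by (auto simp: core_def)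
        then show ?thesis using k by force
      qed
      show "cmod (a f - m f) \<le> (C + 2) * k"
      proof (cases "a \<in> A0")
        case True
        then have "cmod (a f - m f) \<le> 1 * k" using core by simp
        also have "\<dots> \<le> (C + 2) * k" using C \<open>0 \<le> k\<close> by (intro mult_right_mono) auto
        finally show ?thesis .
      next
        case False
        then obtain p where p: "p \<in> R" "a \<in> fst p" using R(3) a by blast
        have "\<forall>a\<in>insert (\<lambda>f. 0) (\<Union>(P p)). cmod (a f) \<le> k"
          by (intro ballI k[rule_format] subsetD[OF P_M[OF p(1)]])
        then have "cmod (a f - t p f) \<le> C * k"
          using tP(6)[OF p(1)] p(2) f unfolding norms_differences_def by blast
        moreover have "cmod (t p f - snd p f) \<le> k"
          using k link_M[OF p(1)] by (force simp: link_def)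
        moreover have "cmod (snd p f - m f) \<le> k" using core R(4) p by blast
        \<comment> \<open>Telescoping \<open>a - m\<close> through the top of the block and its
          coarse point: the errors \<open>C * k\<close>, \<open>k\<close> and \<open>k\<close> give
          the constant \<open>C + 2\<close>.\<close>
        ultimately show ?thesis
          using norm_triangle_ineq[of "a f - t p f" "(t p f - snd p f) + (snd p f - m f)"]
            norm_triangle_ineq[of "t p f - snd p f" "snd p f - m f"]
          by (simp add: algebra_simps)
      qed
    qed
    ultimately show ?thesis by blast
  qed
  then show ?case using C by (intro exI[of _ "C + 2"]) auto
qed

section \<open>Realizing systems by point evaluations\<close>

lemma cb_derivative_antimono: "d \<le> e \<Longrightarrow> cb_derivative X e \<subseteq> cb_derivative X d"
proof (induction e rule: less_induct)
  case (less e)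
  show ?case
  proof (cases "d = e")
    case False
    then have "d < e" using less.prems by simp
    show ?thesis
    proof (cases e rule: omega1_cases)
      case 1
      then show ?thesis using \<open>d < e\<close> by simp
    next
      case (2 b)
      then have "d \<le> b" "b < e" using \<open>d < e\<close> less_osuc[of b] by auto
      then have "cb_derivative X b \<subseteq> cb_derivative X d" by (rule less.IH[rotated])
      then show ?thesis using 2 by (auto simp: nonisolated_points_def)
    next
      case 3
      then show ?thesis using \<open>d < e\<close> by auto
    qed
  qed simp
qed

lemma cb_derivative_subset_topspace: "cb_derivative X d \<subseteq> topspace X"
  using cb_derivative_antimono[of 0 d X] by simp

lemma cb_derivative_accumulation:
  assumes x: "x \<in> cb_derivative X d" and "e < d" and W: "openin X W" "x \<in> W"
  obtains y where "y \<in> W" "y \<in> cb_derivative X e" "y \<noteq> x"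
proof -
  have "x \<in> nonisolated_points (subtopology X (cb_derivative X e))"
    using cb_derivative_antimono[of "osuc e" d X] x \<open>e < d\<close> by (auto simp: osuc_le_iff)
  then have e: "x \<in> cb_derivative X e"
    and "\<not> openin (subtopology X (cb_derivative X e)) {x}"
    by (auto simp: nonisolated_points_def)
  then have "W \<inter> cb_derivative X e \<noteq> {x}"
    using W(1) by (auto simp: openin_subtopology)
  then show ?thesis using that W(2) e by blast
qed

text \<open>Inside a neighbourhood of \<open>x\<close> a point other than \<open>x\<close> is
  separated from \<open>x\<close>, and the construction continues in the new neighbourhood of
  \<open>x\<close>. All later sets lie there, hence miss the earlier one.\<close>

lemma ex_disjoint_open_sequence:
  fixes r :: "nat \<Rightarrow> omega1"
  assumes "Hausdorff_space X" "x \<in> cb_derivative X d" "\<And>k. r k < d" "openin X V" "x \<in> V"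
  obtains U y where "\<And>k. openin X (U k)" "\<And>k. U k \<subseteq> V" "\<And>k. x \<notin> U k"
    "\<And>k. y k \<in> U k" "\<And>k. y k \<in> cb_derivative X (r k)"
    "\<And>i j. i \<noteq> j \<Longrightarrow> U i \<inter> U j = {}"
proof -
  \<comment> \<open>The dependent choice runs over the neighbourhoods \<open>W\<close> only; the
    sets \<open>U\<close> and the points \<open>y\<close> are extracted afterwards.\<close>
  define step where "step k W W' \<longleftrightarrow> (\<exists>U y. openin X U \<and> U \<subseteq> W \<and> W' \<subseteq> W \<and> U \<inter> W' = {} \<and>
    y \<in> U \<and> y \<in> cb_derivative X (r k))" for k W W'
  have "\<exists>W'. (openin X W' \<and> W' \<subseteq> V \<and> x \<in> W') \<and> step k W W'"
    if W: "openin X W \<and> W \<subseteq> V \<and> x \<in> W" for k W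
  proof -
    obtain y where y: "y \<in> W" "y \<in> cb_derivative X (r k)" "y \<noteq> x"
      using cb_derivative_accumulation[OF assms(2,3)] W by blast
    have "y \<in> topspace X" "x \<in> topspace X" using y(1) W openin_subset by blast+
    then obtain U U' where U: "openin X U" "openin X U'" "y \<in> U" "x \<in> U'" "disjnt U U'"
      using assms(1)[unfolded Hausdorff_space_def, rule_format, of y x] y(3) by blast
    have "step k W (U' \<inter> W)"
      unfolding step_def
      by (rule exI[of _ "U \<inter> W"], rule exI[of _ y])
        (use U y W in \<open>auto simp: disjnt_def\<close>)
    moreover have "openin X (U' \<inter> W) \<and> U' \<inter> W \<subseteq> V \<and> x \<in> U' \<inter> W"
      using U W by auto
    ultimately have "\<exists>W'. (openin X W' \<and> W' \<subseteq> V \<and> x \<in> W') \<and> step k W W'"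
      by (intro exI[of _ "U' \<inter> W"] conjI) simp_all
    then show ?thesis .
  qed
  note ex_step = this
  obtain W where W: "\<And>k. openin X (W k) \<and> W k \<subseteq> V \<and> x \<in> W k" "\<And>k. step k (W k) (W (Suc k))"
    using dependent_nat_choice[of "\<lambda>_ W. openin X W \<and> W \<subseteq> V \<and> x \<in> W" step, OF _ ex_step]
      assms(4,5) by (metis order.refl)
  then obtain U y where U: "\<And>k. openin X (U k)" "\<And>k. U k \<subseteq> W k" "\<And>k. W (Suc k) \<subseteq> W k"
    "\<And>k. U k \<inter> W (Suc k) = {}" "\<And>k. y k \<in> U k" "\<And>k. y k \<in> cb_derivative X (r k)"
    unfolding step_def by metis
  have less: "U i \<inter> U j = {}" if "i < j" for i j
  proof -
    have "W j \<subseteq> W (Suc i)" using lift_Suc_antimono_le[of W "Suc i" j, OF U(3)] that by simp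
    then show ?thesis using U(2)[of j] U(4)[of i] by blast
  qed
  have disj: "U i \<inter> U j = {}" if "i \<noteq> j" for i j
    using that less[of i j] less[of j i] by (cases i j rule: linorder_cases) auto
  have "U k \<subseteq> V" "x \<notin> U k" for k
    using U(2)[of k] U(4)[of k] W(1)[of k] W(1)[of "Suc k"] by blast+
  then show ?thesis using that[of U y] U(1,5,6) disj by simp
qed

lemma continuous_map_uniform_approx:
  fixes h :: "'a \<Rightarrow> complex"
  assumes "\<And>e. 0 < e \<Longrightarrow> \<exists>g. continuous_map X euclidean g \<and> (\<forall>x\<in>topspace X. cmod (g x - h x) < e)"
  shows "continuous_map X euclidean h"
proof -
  have "\<forall>n. \<exists>g. continuous_map X euclidean g \<and>
      (\<forall>x\<in>topspace X. cmod (g x - h x) < inverse (real (Suc n)))"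
    using assms by simp
  then obtain g where g: "\<And>n. continuous_map X euclidean (g n)"
    "\<And>n x. x \<in> topspace X \<Longrightarrow> cmod (g n x - h x) < inverse (real (Suc n))" by metis
  have "continuous_map X Met_TC.mtopology h"
  proof (rule Met_TC.continuous_map_uniform_limit[where f = g])
    show "\<forall>\<^sub>F n in sequentially. continuous_map X Met_TC.mtopology (g n)"
      using g(1) by simp
  next
    fix e :: real assume "0 < e"
    then obtain N where N: "inverse (real (Suc N)) < e" using reals_Archimedean by blast
    show "\<forall>\<^sub>F n in sequentially. \<forall>x\<in>topspace X. h x \<in> UNIV \<and> dist (g n x) (h x) < e"
    proof (rule eventually_sequentiallyI[of N], intro ballI conjI UNIV_I)
      fix n x assume "N \<le> n" "x \<in> topspace X"
      then have "cmod (g n x - h x) < inverse (real (Suc n))" using g(2) by blast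
      also have "\<dots> \<le> inverse (real (Suc N))" using \<open>N \<le> n\<close> by (simp add: field_simps)
      finally show "dist (g n x) (h x) < e" using N by (simp add: dist_norm)
    qed
  qed simp
  then show ?thesis by simp
qed

section \<open>Linear maps with prescribed point evaluations\<close>

definition lin_on :: "('l \<Rightarrow> complex) set \<Rightarrow> (('l \<Rightarrow> complex) \<Rightarrow> complex) \<Rightarrow> bool"
  where "lin_on E a \<longleftrightarrow> (\<forall>f\<in>E. \<forall>g\<in>E. a (\<lambda>x. f x + g x) = a f + a g) \<and>
    (\<forall>c. \<forall>f\<in>E. a (\<lambda>x. c * f x) = c * a f)"

lemma lin_on_combination: "lin_on E a \<Longrightarrow> lin_on E b \<Longrightarrow> lin_on E (\<lambda>f. c * a f + d * b f)"
  by (simp add: lin_on_def algebra_simps)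

lemma lin_on_diff: "lin_on E a \<Longrightarrow> lin_on E b \<Longrightarrow> lin_on E (\<lambda>f. a f - b f)"
  by (simp add: lin_on_def algebra_simps)

text \<open>The bound is stated for arbitrary convex sets containing 0, because in the induction it
  is applied to translated functionals; discs around 0 give back the norm bound.\<close>

definition realizes where
  "realizes X E A U S \<longleftrightarrow> (\<forall>f\<in>E. continuous_map X euclidean (S f)) \<and>
    (\<forall>f y. y \<notin> U \<longrightarrow> S f y = 0) \<and> (\<forall>y. lin_on E (\<lambda>f. S f y)) \<and>
    (\<forall>f\<in>E. \<forall>W y. convex W \<longrightarrow> 0 \<in> W \<longrightarrow> (\<forall>a\<in>A. a f \<in> W) \<longrightarrow> S f y \<in> W) \<and>
    (\<forall>a\<in>A. \<exists>y\<in>U. \<forall>f\<in>E. S f y = a f)"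

text \<open>Near \<open>x\<close> the map starts from the constant \<open>m f\<close>, cut off by a
  Urysohn function. The pieces get disjoint open sets around points of lower derivatives, and there
  the induction hypothesis adds the deviations \<open>a f - m f\<close>. For each \<open>f\<close>
  all but finitely many pieces deviate little, so the sum is continuous.\<close>

lemma cb_system_realizes:
  fixes X :: "'k topology"
  assumes X: "compact_space X" "Hausdorff_space X"
  shows "cb_system E d m A \<Longrightarrow> \<forall>a\<in>A. lin_on E a \<Longrightarrow> x \<in> cb_derivative X d \<Longrightarrow>
    openin X U \<Longrightarrow> x \<in> U \<Longrightarrow> \<exists>S. realizes X E A U S"
proof (induction d arbitrary: m A x U rule: less_induct)
  case (less d)
  have norm: "normal_space X"
    using X compact_Hausdorff_or_regular_imp_normal_space by blast
  obtain P where P: "countable P" "\<forall>B\<in>P. \<exists>s<d. \<exists>t. cb_system E s t B"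
    "\<forall>f\<in>E. \<forall>e>0. finite {B\<in>P. \<exists>a\<in>B. e \<le> cmod (a f - m f)}"
    "A = insert m (\<Union>P)" using cb_systemD[OF less.prems(1)] by blast
  then obtain r where r: "\<And>B. B \<in> P \<Longrightarrow> r B < d \<and> (\<exists>t. cb_system E (r B) t B)" by metis
  have xX: "x \<in> topspace X" using cb_derivative_subset_topspace less.prems(3) by fastforce
  have "closedin X {x}" using X(2) xX by (simp add: closedin_Hausdorff_singleton)
  then obtain V where V: "openin X V" "x \<in> V" "X closure_of V \<subseteq> U"
    using norm[unfolded normal_space_alt, rule_format, of "{x}" U] less.prems(4,5) by blast
  have VX: "V \<subseteq> topspace X" and Vcl: "V \<subseteq> X closure_of V"
    using openin_subset[OF V(1)] closure_of_subset by auto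
  then have "V \<subseteq> U" using V(3) by blast
  have clU: "closedin X (topspace X - U)" using less.prems(4) by blast
  have disj: "disjnt (topspace X - U) (X closure_of V)" using V(3) by (auto simp: disjnt_def)
  obtain phi :: "'k \<Rightarrow> real" where phi: "continuous_map X (top_of_set {0..1}) phi"
    "phi ` (topspace X - U) \<subseteq> {0}" "phi ` (X closure_of V) \<subseteq> {1}"
    by (rule Urysohn_lemma[OF norm clU closedin_closure_of disj zero_le_one]) (rule that)
  \<comment> \<open>\<open>phi\<close> is unspecified outside \<open>topspace X\<close>; with the
    value 0 there, \<open>h\<close> vanishes at every point outside \<open>U\<close>, as membership
    in \<open>cfun_space\<close> requires later.\<close>
  define h :: "'k \<Rightarrow> complex" where "h y = (if y \<in> topspace X then of_real (phi y) else 0)" for y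
  have phic: "continuous_map X euclideanreal phi" and phi01: "phi ` topspace X \<subseteq> {0..1}"
    using phi(1) by (auto simp: continuous_map_in_subtopology)
  have "continuous_map X euclidean (\<lambda>y. of_real (phi y) :: complex)"
    using continuous_map_compose[OF phic, of euclidean complex_of_real]
    by (simp add: o_def continuous_on_of_real continuous_on_id)
  then have h_cont: "continuous_map X euclidean h"
    by (rule continuous_map_eq) (simp add: h_def)
  have h0: "h y = 0" if "y \<notin> U" for y
    using that phi(2) by (auto simp: h_def)
  have h1: "h y = 1" if "y \<in> V" for y
  proof -
    have "y \<in> X closure_of V" "y \<in> topspace X"
      using that VX Vcl by blast+
    then show ?thesis using phi(3) by (auto simp: h_def)
  qed
  have h_convex: "\<exists>t\<in>{0..1}. h y = of_real t" for y
    using phi01 by (cases "y \<in> topspace X") (auto simp: h_def intro: bexI[of _ 0])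
  have "\<exists>O' y. (\<forall>B\<in>P. openin X (O' B) \<and> O' B \<subseteq> V \<and> x \<notin> O' B \<and> y B \<in> O' B \<and>
      y B \<in> cb_derivative X (r B)) \<and> (\<forall>B\<in>P. \<forall>C\<in>P. B \<noteq> C \<longrightarrow> O' B \<inter> O' C = {})"
  proof (cases "P = {}")
    case False
    \<comment> \<open>\<open>P\<close> may be finite, in which case \<open>from_nat_into\<close>
      repeats pieces; the index \<open>to_nat_on P B\<close> selects one of the disjoint sets for
      each \<open>B\<close>.\<close>
    define b where "b = from_nat_into P"
    have b: "b k \<in> P" for k using False by (simp add: b_def from_nat_into)
    have bt: "b (to_nat_on P B) = B" if "B \<in> P" for B
      using that P(1) by (simp add: b_def)
    obtain O' y where O': "\<And>k. openin X (O' k)" "\<And>k. O' k \<subseteq> V" "\<And>k. x \<notin> O' k"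
      "\<And>k. y k \<in> O' k" "\<And>k. y k \<in> cb_derivative X (r (b k))"
      "\<And>i j. i \<noteq> j \<Longrightarrow> O' i \<inter> O' j = {}"
      using ex_disjoint_open_sequence[OF X(2) less.prems(3) _ V(1,2), of "\<lambda>k. r (b k)"] r b by blast
    have "O' (to_nat_on P B) \<inter> O' (to_nat_on P C) = {}" if "B \<in> P" "C \<in> P" "B \<noteq> C" for B C
      using that bt by (intro O'(6)) metis
    moreover have "y (to_nat_on P B) \<in> cb_derivative X (r B)" if "B \<in> P" for B
      using O'(5)[of "to_nat_on P B"] bt[OF that] by simp
    ultimately show ?thesis using O'
      by (intro exI[of _ "\<lambda>B. O' (to_nat_on P B)"] exI[of _ "\<lambda>B. y (to_nat_on P B)"]) auto
  qed simp
  then obtain O' y where "\<forall>B\<in>P. openin X (O' B) \<and> O' B \<subseteq> V \<and> x \<notin> O' B \<and> y B \<in> O' B \<and>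
      y B \<in> cb_derivative X (r B)" "\<forall>B\<in>P. \<forall>C\<in>P. B \<noteq> C \<longrightarrow> O' B \<inter> O' C = {}"
    by (elim exE conjE)
  then have O': "\<And>B. B \<in> P \<Longrightarrow> openin X (O' B)" "\<And>B. B \<in> P \<Longrightarrow> O' B \<subseteq> V"
    "\<And>B. B \<in> P \<Longrightarrow> x \<notin> O' B" "\<And>B. B \<in> P \<Longrightarrow> y B \<in> O' B"
    "\<And>B. B \<in> P \<Longrightarrow> y B \<in> cb_derivative X (r B)"
    "\<And>B C. B \<in> P \<Longrightarrow> C \<in> P \<Longrightarrow> B \<noteq> C \<Longrightarrow> O' B \<inter> O' C = {}"
    by simp_all
  have m: "lin_on E m" using less.prems(2) P(4) by simp
  let ?t = "\<lambda>a f. a f - m f"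
  have "\<exists>S. realizes X E (?t ` B) (O' B) S" if B: "B \<in> P" for B
  proof -
    obtain t where t: "cb_system E (r B) t B" using r[OF B] by blast
    have "\<forall>a\<in>?t ` B. lin_on E a"
      using less.prems(2) P(4) B m by (auto intro!: lin_on_diff)
    then show ?thesis
      using r[OF B] less.IH[OF _ cb_system_translate[OF t] _ O'(5)[OF B] O'(1)[OF B] O'(4)[OF B]]
      by simp
  qed
  then obtain S where S: "\<And>B. B \<in> P \<Longrightarrow> realizes X E (?t ` B) (O' B) (S B)" by metis
  have S_cont: "continuous_map X euclidean (S B f)" if "B \<in> P" "f \<in> E" for B f
    using S[OF that(1)] that(2) by (simp add: realizes_def)
  have S_0: "S B f z = 0" if "B \<in> P" "z \<notin> O' B" for B f z
    using S[OF that(1)] that(2) by (simp add: realizes_def)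
  have S_lin: "lin_on E (\<lambda>f. S B f z)" if "B \<in> P" for B z
    using S[OF that(1)] by (simp add: realizes_def)
  have S_convex: "S B f z \<in> W"
    if "B \<in> P" "f \<in> E" "convex W" "0 \<in> W" "\<forall>a\<in>B. a f - m f \<in> W" for B f W z
    using S[OF that(1)] that(2-) by (simp add: realizes_def)
  have S_ev: "\<exists>z\<in>O' B. \<forall>f\<in>E. S B f z = a f - m f" if "B \<in> P" "a \<in> B" for B a
    using S[OF that(1)] that(2) by (simp add: realizes_def)
  \<comment> \<open>The sets \<open>O' B\<close> are disjoint, so the sum has at most one term at
    each point.\<close>
  define T where "T f z = m f * h z + (\<Sum>B\<in>{B\<in>P. z \<in> O' B}. S B f z)" for f z
  have at: "{C\<in>P. z \<in> O' C} = {B}" if "B \<in> P" "z \<in> O' B" for z B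
    using that O'(6) by blast
  have T_in: "T f z = m f + S B f z" if "B \<in> P" "z \<in> O' B" for B f z
    using h1[of z] O'(2)[of B] that by (auto simp: T_def at[OF that])
  have T_out: "T f z = m f * h z" if "\<And>B. B \<in> P \<Longrightarrow> z \<notin> O' B" for f z
  proof -
    have none: "{B\<in>P. z \<in> O' B} = {}" using that by blast
    show ?thesis unfolding T_def none by simp
  qed
  have "realizes X E A U T"
    unfolding realizes_def
  proof (intro conjI ballI allI impI)
    fix f assume f: "f \<in> E"
    show "continuous_map X euclidean (T f)"
    proof (rule continuous_map_uniform_approx)
      fix e :: real assume "0 < e"
      \<comment> \<open>For a piece outside \<open>F\<close> the convexity clause, applied to the
        disc of radius \<open>e / 2\<close>, bounds its contribution; so the finite sum
        \<open>g\<close> approximates \<open>T f\<close>.\<close>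
      define F where "F = {B\<in>P. \<exists>a\<in>B. e / 2 \<le> cmod (a f - m f)}"
      have "F \<subseteq> P" by (auto simp: F_def)
      moreover have "finite F" unfolding F_def
        by (rule P(3)[rule_format]) (use f \<open>0 < e\<close> in auto)
      ultimately have F: "finite F" "F \<subseteq> P" by simp_all
      define g where "g z = m f * h z + (\<Sum>B\<in>F. S B f z)" for z
      have "continuous_map X euclidean (\<lambda>z. m f * h z)"
        using continuous_map_compose[OF h_cont, of euclidean "\<lambda>w. m f * w"]
        by (simp add: o_def continuous_intros)
      moreover have "continuous_map X euclidean (\<lambda>z. \<Sum>B\<in>F. S B f z)"
        using F S_cont f by (intro continuous_map_sum) auto
      ultimately have "continuous_map X euclidean g"
        unfolding g_def by (intro continuous_map_add)
      moreover have "cmod (g z - T f z) < e" for z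
      proof (cases "\<exists>B\<in>P. z \<in> O' B")
        case True
        then obtain B where B: "B \<in> P" "z \<in> O' B" by blast
        have "S C f z = 0" if "C \<in> F" "C \<noteq> B" for C
          using that F(2) B O'(6) by (intro S_0) blast+
        then have "(\<Sum>C\<in>F. S C f z) = (\<Sum>C\<in>F. if C = B then S B f z else 0)"
          by (intro sum.cong) auto
        then have sum: "(\<Sum>C\<in>F. S C f z) = (if B \<in> F then S B f z else 0)"
          using F(1) by simp
        have hz: "h z = 1" using h1 O'(2) B by blast
        show ?thesis
        proof (cases "B \<in> F")
          case True
          then show ?thesis using \<open>0 < e\<close> by (simp add: g_def sum T_in[OF B] hz)
        next
          case False
          then have "\<forall>a\<in>B. a f - m f \<in> cball 0 (e / 2)" using B(1) by (force simp: F_def)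
          then have "S B f z \<in> cball 0 (e / 2)"
            using \<open>0 < e\<close> f B(1) by (intro S_convex) auto
          then show ?thesis using False \<open>0 < e\<close> by (simp add: g_def sum T_in[OF B] hz)
        qed
      next
        case False
        then have "(\<Sum>C\<in>F. S C f z) = 0" using F(2) S_0 by (intro sum.neutral) blast
        moreover have "T f z = m f * h z" using False T_out by blast
        ultimately show ?thesis using \<open>0 < e\<close> by (simp add: g_def)
      qed
      ultimately show "\<exists>g. continuous_map X euclidean g \<and>
          (\<forall>z\<in>topspace X. cmod (g z - T f z) < e)" by blast
    qed
  next
    fix f z assume "z \<notin> U"
    then have "z \<notin> O' B" if "B \<in> P" for B using that O'(2) \<open>V \<subseteq> U\<close> by blast
    then show "T f z = 0" using T_out h0[OF \<open>z \<notin> U\<close>] by simp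
  next
    fix z
    show "lin_on E (\<lambda>f. T f z)"
    proof (cases "\<exists>B\<in>P. z \<in> O' B")
      case True
      then obtain B where B: "B \<in> P" "z \<in> O' B" by blast
      show ?thesis unfolding T_in[OF B]
        using lin_on_combination[OF m S_lin[OF B(1)], of 1 1] by simp
    next
      case False
      then have "T f z = m f * h z" for f using T_out by blast
      then show ?thesis using lin_on_combination[OF m m, of "h z" 0] by (simp add: mult.commute)
    qed
  next
    fix f W z assume f: "f \<in> E" and W: "convex W" "0 \<in> W" "\<forall>a\<in>A. a f \<in> W"
    then have mW: "m f \<in> W" using P(4) by simp
    show "T f z \<in> W"
    proof (cases "\<exists>B\<in>P. z \<in> O' B")
      case True
      then obtain B where B: "B \<in> P" "z \<in> O' B" by blast
      \<comment> \<open>The translate of \<open>W\<close> by \<open>- m f\<close> contains 0 because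
        \<open>m f\<close> is in \<open>W\<close>. Discs around 0 would not be stable under this
        translation.\<close>
      have "S B f z \<in> (\<lambda>w. - m f + w) ` W"
      proof (rule S_convex[OF B(1) f])
        show "convex ((\<lambda>w. - m f + w) ` W)" using W(1) by (rule convex_translation)
        show "0 \<in> (\<lambda>w. - m f + w) ` W" using mW by (intro image_eqI[of _ _ "m f"]) auto
        show "\<forall>a\<in>B. a f - m f \<in> (\<lambda>w. - m f + w) ` W"
        proof
          fix a assume "a \<in> B"
          then have "a f \<in> W" using W(3) P(4) B(1) by blast
          then show "a f - m f \<in> (\<lambda>w. - m f + w) ` W"
            by (intro image_eqI[of _ _ "a f"]) simp_all
        qed
      qed
      then show ?thesis using T_in[OF B] by auto
    next
      case False
      \<comment> \<open>Away from the sets \<open>O' B\<close> the value lies on the segment from 0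
        to \<open>m f\<close>.\<close>
      then have "T f z = m f * h z" using T_out by blast
      moreover obtain t where "t \<in> {0..1}" "h z = of_real t" using h_convex by blast
      ultimately have "T f z = (1 - t) *\<^sub>R 0 + t *\<^sub>R m f" "0 \<le> t" "t \<le> 1"
        by (simp_all add: scaleR_conv_of_real)
      then show ?thesis using convexD_alt[OF W(1,2) mW] by metis
    qed
  next
    fix a assume "a \<in> A"
    then consider "a = m" | B where "B \<in> P" "a \<in> B" using P(4) by blast
    then show "\<exists>z\<in>U. \<forall>f\<in>E. T f z = a f"
    proof cases
      case 1
      have "T f x = m f * h x" for f using O'(3) by (intro T_out) blast
      then show ?thesis using h1[OF V(2)] less.prems(5) 1 by auto
    next
      case (2 B)
      then obtain z where z: "z \<in> O' B" "\<forall>f\<in>E. S B f z = a f - m f" using S_ev by blast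
      then have "\<forall>f\<in>E. T f z = a f" by (simp add: T_in[OF 2(1) z(1)])
      then show ?thesis using z(1) O'(2)[OF 2(1)] \<open>V \<subseteq> U\<close> by blast
    qed
  qed
  then show ?case by blast
qed

section \<open>Stable phase retrieval\<close>

lemma abs_square_diff_le:
  fixes x y :: real
  assumes "\<bar>x - y\<bar> \<le> d" "0 \<le> x" "0 \<le> y" "x \<le> B" "y \<le> B"
  shows "\<bar>x\<^sup>2 - y\<^sup>2\<bar> \<le> 2 * B * d"
proof -
  have "x\<^sup>2 - y\<^sup>2 = (x + y) * (x - y)" by (simp add: power2_eq_square algebra_simps)
  then have "\<bar>x\<^sup>2 - y\<^sup>2\<bar> = (x + y) * \<bar>x - y\<bar>" using assms by (simp add: abs_mult)
  also have "\<dots> \<le> (2 * B) * d" using assms by (intro mult_mono) auto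
  finally show ?thesis by simp
qed

text \<open>Polarization: the moduli of \<open>u\<close>, \<open>v\<close>, \<open>u + v\<close> and
  \<open>u + \<i> * v\<close> determine \<open>u * cnj v\<close>.\<close>

lemma Re_mult_cnj: "2 * Re (u * cnj v) = (cmod (u + v))\<^sup>2 - (cmod u)\<^sup>2 - (cmod v)\<^sup>2"
  unfolding cmod_power2 by (simp add: power2_eq_square algebra_simps)

lemma Im_mult_cnj: "2 * Im (u * cnj v) = (cmod (u + \<i> * v))\<^sup>2 - (cmod u)\<^sup>2 - (cmod v)\<^sup>2"
  unfolding cmod_power2 by (simp add: power2_eq_square algebra_simps)

text \<open>By polarization the tests control all products \<open>p a * cnj (p b)\<close> up to a
  multiple of \<open>R * e\<close>. Dividing by \<open>p a0\<close>, of modulus at least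
  \<open>R / 2\<close>, recovers \<open>p b\<close> with an error free of \<open>R\<close>.\<close>

lemma phase_alignment_aux:
  fixes p q :: "'a \<Rightarrow> complex"
  assumes tests: "\<And>a b c. a \<in> A \<Longrightarrow> b \<in> A \<Longrightarrow> c \<in> {1, \<i>} \<Longrightarrow>
      \<bar>cmod (p a + c * p b) - cmod (q a + c * q b)\<bar> \<le> 2 * e"
    and R: "\<And>a. a \<in> A \<Longrightarrow> cmod (p a) \<le> R" "\<And>a. a \<in> A \<Longrightarrow> cmod (q a) \<le> R"
    and a0: "a0 \<in> A" "R \<le> 2 * cmod (p a0)"
  shows "\<exists>l. cmod l = 1 \<and> (\<forall>b\<in>A. cmod (p b - l * q b) \<le> 26 * e)"
proof -
  \<comment> \<open>With \<open>b = a\<close> and \<open>c = 1\<close> the test compares twice the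
    moduli.\<close>
  have single: "\<bar>cmod (p a) - cmod (q a)\<bar> \<le> e" if "a \<in> A" for a
    using tests[OF that that, of 1] by (simp add: norm_mult flip: mult_2)
  have "0 \<le> e" using single[OF a0(1)] by linarith
  have "0 \<le> R" using R(1)[OF a0(1)] norm_ge_zero order_trans by blast
  have sq: "\<bar>(cmod (p a))\<^sup>2 - (cmod (q a))\<^sup>2\<bar> \<le> 2 * R * e" if "a \<in> A" for a
    using abs_square_diff_le[OF single[OF that]] R that by simp
  have sq2: "\<bar>(cmod (p a + c * p b))\<^sup>2 - (cmod (q a + c * q b))\<^sup>2\<bar> \<le> 2 * (2 * R) * (2 * e)"
    if "a \<in> A" "b \<in> A" "c \<in> {1, \<i>}" for a b c
  proof (rule abs_square_diff_le)
    have c: "cmod c = 1" using that(3) by auto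
    show "cmod (p a + c * p b) \<le> 2 * R"
      using norm_triangle_ineq[of "p a" "c * p b"] R(1)[OF that(1)] R(1)[OF that(2)] c
      by (simp add: norm_mult)
    show "cmod (q a + c * q b) \<le> 2 * R"
      using norm_triangle_ineq[of "q a" "c * q b"] R(2)[OF that(1)] R(2)[OF that(2)] c
      by (simp add: norm_mult)
  qed (use tests that in auto)
  \<comment> \<open>The differences of squares contribute 8, 2 and 2 times \<open>R * e\<close> to
    \<open>2 * Re ?D\<close>, and likewise to the imaginary part; halving and adding the two parts
    gives 12.\<close>
  have D: "cmod (p a * cnj (p b) - q a * cnj (q b)) \<le> 12 * R * e" if "a \<in> A" "b \<in> A" for a b
  proof -
    let ?D = "p a * cnj (p b) - q a * cnj (q b)"
    have "2 * Re ?D = ((cmod (p a + p b))\<^sup>2 - (cmod (q a + q b))\<^sup>2)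
        - ((cmod (p a))\<^sup>2 - (cmod (q a))\<^sup>2) - ((cmod (p b))\<^sup>2 - (cmod (q b))\<^sup>2)"
      using Re_mult_cnj[of "p a" "p b"] Re_mult_cnj[of "q a" "q b"]
      by (simp only: minus_complex.sel right_diff_distrib)
    then have "\<bar>2 * Re ?D\<bar> \<le> 12 * R * e"
      using sq[OF that(1)] sq[OF that(2)] sq2[OF that, of 1] unfolding abs_le_iff by simp
    moreover have "2 * Im ?D = ((cmod (p a + \<i> * p b))\<^sup>2 - (cmod (q a + \<i> * q b))\<^sup>2)
        - ((cmod (p a))\<^sup>2 - (cmod (q a))\<^sup>2) - ((cmod (p b))\<^sup>2 - (cmod (q b))\<^sup>2)"
      using Im_mult_cnj[of "p a" "p b"] Im_mult_cnj[of "q a" "q b"]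
      by (simp only: minus_complex.sel right_diff_distrib)
    then have "\<bar>2 * Im ?D\<bar> \<le> 12 * R * e"
      using sq[OF that(1)] sq[OF that(2)] sq2[OF that, of \<i>] unfolding abs_le_iff by simp
    ultimately show ?thesis using cmod_le[of ?D] by (simp add: abs_mult)
  qed
  define z w where "z = p a0" and "w = q a0"
  show ?thesis
  proof (cases "w = 0 \<or> R = 0")
    case True
    \<comment> \<open>In either case all values of \<open>p\<close> and \<open>q\<close> are at most
      \<open>2 * e\<close>, and the phase 1 serves.\<close>
    have small: "R \<le> 2 * e" using a0 single[OF a0(1)] True \<open>0 \<le> e\<close> by (auto simp: z_def w_def)
    show ?thesis
    proof (intro exI[of _ 1] conjI ballI)
      fix b assume "b \<in> A"
      then show "cmod (p b - 1 * q b) \<le> 26 * e"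
        using norm_triangle_ineq4[of "p b" "q b"] R[of b] small \<open>0 \<le> e\<close> by simp
    qed simp
  next
    case False
    then have "0 < R" "w \<noteq> 0" using \<open>0 \<le> R\<close> by auto
    then have z: "0 < cmod z" "R \<le> 2 * cmod z" using a0(2) by (auto simp: z_def)
    \<comment> \<open>The product estimate says that \<open>p b\<close> is close to
      \<open>cnj w / cnj z\<close> times \<open>q b\<close>; \<open>l\<close> is this quotient
      normalized to modulus 1. The quotient costs \<open>24 * e\<close>, by
      \<open>R <= 2 * cmod z\<close>, and the normalization another \<open>2 * e\<close>.\<close>
    define l where "l = (cnj w / cnj z) * of_real (cmod z / cmod w)"
    have l: "cmod l = 1" using z \<open>w \<noteq> 0\<close> by (simp add: l_def norm_mult norm_divide)
    have "cmod (p b - l * q b) \<le> 26 * e" if b: "b \<in> A" for b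
    proof -
      have "p b - cnj w / cnj z * q b = cnj (z * cnj (p b) - w * cnj (q b)) / cnj z"
        using z by (simp add: field_simps)
      then have "cmod (p b - cnj w / cnj z * q b) = cmod (z * cnj (p b) - w * cnj (q b)) / cmod z"
        by (simp only: norm_divide complex_mod_cnj)
      also have "\<dots> \<le> 24 * e"
      proof -
        have "cmod (z * cnj (p b) - w * cnj (q b)) \<le> 12 * R * e"
          using D[OF a0(1) b] by (simp add: z_def w_def)
        also have "\<dots> \<le> 12 * (2 * cmod z) * e"
          using z(2) \<open>0 \<le> e\<close> by (intro mult_right_mono) auto
        finally show ?thesis using z(1) by (simp add: field_simps)
      qed
      finally have 1: "cmod (p b - cnj w / cnj z * q b) \<le> 24 * e" .
      have "cnj w / cnj z - l = (cnj w / cnj z) * of_real (1 - cmod z / cmod w)"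
        by (simp add: l_def algebra_simps)
      then have "cmod (cnj w / cnj z - l) = cmod w / cmod z * \<bar>1 - cmod z / cmod w\<bar>"
        by (simp only: norm_mult norm_divide complex_mod_cnj norm_of_real)
      also have "\<dots> = \<bar>cmod z - cmod w\<bar> / cmod z"
        using \<open>w \<noteq> 0\<close> z(1) by (simp add: abs_if field_simps)
      finally have "cmod ((cnj w / cnj z - l) * q b) = \<bar>cmod z - cmod w\<bar> / cmod z * cmod (q b)"
        by (simp add: norm_mult)
      also have "\<dots> \<le> e / cmod z * (2 * cmod z)"
        using single[OF a0(1)] R(2)[OF b] z \<open>0 \<le> e\<close>
        by (intro mult_mono divide_right_mono) (auto simp: z_def w_def)
      also have "\<dots> = 2 * e" using z by simp
      finally have 2: "cmod ((cnj w / cnj z - l) * q b) \<le> 2 * e" .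
      have "p b - l * q b = (p b - cnj w / cnj z * q b) + (cnj w / cnj z - l) * q b"
        by (simp add: algebra_simps)
      then have "cmod (p b - l * q b) \<le> 24 * e + 2 * e"
        using order_trans[OF norm_triangle_ineq add_mono[OF 1 2]] by metis
      then show ?thesis by simp
    qed
    then show ?thesis using l by blast
  qed
qed

text \<open>Some \<open>a0\<close> reaches half of the common supremum of the moduli of
  \<open>p\<close> and \<open>q\<close> for one of the two. The auxiliary lemma is applied with that
  function first; after a swap the conjugate phase is the inverse one.\<close>

lemma phase_alignment:
  fixes p q :: "'a \<Rightarrow> complex"
  assumes tests: "\<And>a b c. a \<in> A \<Longrightarrow> b \<in> A \<Longrightarrow> c \<in> {1, \<i>} \<Longrightarrow>
      \<bar>cmod (p a + c * p b) - cmod (q a + c * q b)\<bar> \<le> 2 * e"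
    and bounded: "\<And>a. a \<in> A \<Longrightarrow> cmod (p a) \<le> B" "\<And>a. a \<in> A \<Longrightarrow> cmod (q a) \<le> B"
    and "A \<noteq> {}"
  shows "\<exists>l. cmod l = 1 \<and> (\<forall>b\<in>A. cmod (p b - l * q b) \<le> 26 * e)"
proof -
  define S where "S = (\<lambda>a. cmod (p a)) ` A \<union> (\<lambda>a. cmod (q a)) ` A"
  define R where "R = Sup S"
  have S: "S \<noteq> {}" "bdd_above S" using \<open>A \<noteq> {}\<close> bounded by (auto simp: S_def intro!: bdd_aboveI[of _ B])
  have R: "cmod (p a) \<le> R" "cmod (q a) \<le> R" if "a \<in> A" for a
    unfolding R_def by (rule cSup_upper; use S that in \<open>auto simp: S_def\<close>)+
  have "\<exists>x\<in>S. R \<le> 2 * x"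
  proof (cases "R \<le> 0")
    case True
    obtain x where "x \<in> S" using S by blast
    moreover have "0 \<le> x" using \<open>x \<in> S\<close> by (auto simp: S_def)
    ultimately show ?thesis using True by force
  next
    case False
    then have "R / 2 < Sup S" by (simp add: R_def)
    then obtain x where "x \<in> S" "R / 2 < x" using S less_cSup_iff by metis
    then show ?thesis by force
  qed
  then obtain a0 where a0: "a0 \<in> A" "R \<le> 2 * cmod (p a0) \<or> R \<le> 2 * cmod (q a0)"
    by (auto simp: S_def)
  show ?thesis
  proof (cases "R \<le> 2 * cmod (p a0)")
    case True
    show ?thesis
      by (rule phase_alignment_aux[of A p q e R a0]) (use tests R a0(1) True in auto)
  next
    case False
    then have "R \<le> 2 * cmod (q a0)" using a0(2) by blast
    moreover have "\<bar>cmod (q a + c * q b) - cmod (p a + c * p b)\<bar> \<le> 2 * e"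
      if "a \<in> A" "b \<in> A" "c \<in> {1, \<i>}" for a b c
      using tests[OF that] by (simp add: abs_minus_commute)
    ultimately obtain l where l: "cmod l = 1" "\<forall>b\<in>A. cmod (q b - l * p b) \<le> 26 * e"
      using phase_alignment_aux[of A q p e R a0] R a0(1) by blast
    have "cmod (p b - cnj l * q b) = cmod (q b - l * p b)" for b
    proof -
      have "l * cnj l = 1" using complex_norm_square[of l] l(1) by simp
      then have "q b - l * p b = - (l * (p b - cnj l * q b))"
        by (simp add: algebra_simps flip: mult.assoc)
      then show ?thesis using l(1) by (simp add: norm_mult)
    qed
    then show ?thesis using l by (intro exI[of _ "cnj l"]) simp
  qed
qed

section \<open>Linear maps between function spaces and the transfer of phase retrieval\<close>

lemma zero_in_cfun_space: "(\<lambda>x. 0) \<in> cfun_space X"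
  by (simp add: cfun_space_def)

lemma cfun_space_add: "f \<in> cfun_space X \<Longrightarrow> g \<in> cfun_space X \<Longrightarrow> (\<lambda>x. f x + g x) \<in> cfun_space X"
  by (auto simp: cfun_space_def intro: continuous_map_add)

lemma cfun_space_cmult: "f \<in> cfun_space X \<Longrightarrow> (\<lambda>x. c * f x) \<in> cfun_space X"
  using continuous_map_compose[of X euclidean f euclidean "\<lambda>w. c * w"]
  by (auto simp: cfun_space_def o_def intro: continuous_intros)

lemma lin_on_add: "lin_on E a \<Longrightarrow> f \<in> E \<Longrightarrow> g \<in> E \<Longrightarrow> a (\<lambda>x. f x + g x) = a f + a g"
  by (simp add: lin_on_def)

lemma lin_on_cmult: "lin_on E a \<Longrightarrow> f \<in> E \<Longrightarrow> a (\<lambda>x. c * f x) = c * a f"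
  by (simp add: lin_on_def)

lemma clinear_map_add:
  "clinear_map X Y T \<Longrightarrow> f \<in> cfun_space X \<Longrightarrow> g \<in> cfun_space X \<Longrightarrow>
    T (\<lambda>x. f x + g x) = (\<lambda>y. T f y + T g y)"
  by (simp add: clinear_map_def)

lemma clinear_map_cmult:
  "clinear_map X Y T \<Longrightarrow> f \<in> cfun_space X \<Longrightarrow> T (\<lambda>x. c * f x) = (\<lambda>y. c * T f y)"
  by (simp add: clinear_map_def)

lemma csubspace_of_image:
  assumes T: "clinear_map X Y T"
  shows "csubspace_of Y (T ` cfun_space X)"
proof -
  note add = clinear_map_add[OF T] and cmult = clinear_map_cmult[OF T]
  have "T (\<lambda>x. 0) = (\<lambda>y. 0)" using cmult[OF zero_in_cfun_space, of 0] by simp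
  then have "(\<lambda>y. 0) \<in> T ` cfun_space X" using zero_in_cfun_space by (metis imageI)
  moreover have "(\<lambda>y. T f y + T g y) \<in> T ` cfun_space X"
    if "f \<in> cfun_space X" "g \<in> cfun_space X" for f g
    using imageI[OF cfun_space_add[OF that], of T] add[OF that] by simp
  moreover have "(\<lambda>y. c * T f y) \<in> T ` cfun_space X" if "f \<in> cfun_space X" for f c
    using imageI[OF cfun_space_cmult[OF that], of T c] cmult[OF that, of c] by simp
  ultimately show ?thesis
    using T by (simp add: csubspace_of_def clinear_map_def)
qed

lemma norm_le_sup_norm:
  "bdd_above ((\<lambda>x. norm (f x)) ` topspace X) \<Longrightarrow> x \<in> topspace X \<Longrightarrow> norm (f x) \<le> sup_norm X f"
  unfolding sup_norm_def by (rule cSUP_upper)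

lemma sup_norm_le:
  "topspace X \<noteq> {} \<Longrightarrow> (\<And>x. x \<in> topspace X \<Longrightarrow> norm (f x) \<le> B) \<Longrightarrow> sup_norm X f \<le> B"
  unfolding sup_norm_def by (rule cSUP_least)

text \<open>The points realizing \<open>mix c a b\<close> turn the distance \<open>e\<close> of the
  moduli into the tests of \<open>phase_alignment\<close>, where the factor 1/2 in
  \<open>mix\<close> becomes \<open>2 * e\<close>. The phase found on \<open>A\<close> works on all
  of \<open>K\<close>, since \<open>bound\<close> carries the estimate for \<open>f - l g\<close>
  over to its image.\<close>

lemma does_SPR_of_mixes:
  assumes T: "clinear_map L K T" and "topspace K \<noteq> {}" "A \<noteq> {}"
    and lin: "\<And>a. a \<in> A \<Longrightarrow> lin_on (cfun_space L) a"
    and bdd: "\<And>f. f \<in> cfun_space L \<Longrightarrow> \<exists>B. \<forall>a\<in>A. cmod (a f) \<le> B"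
    and bound: "\<And>f B y. f \<in> cfun_space L \<Longrightarrow> \<forall>a\<in>A. cmod (a f) \<le> B \<Longrightarrow> cmod (T f y) \<le> B"
    and ev: "\<And>a b c. a \<in> A \<Longrightarrow> b \<in> A \<Longrightarrow> c \<in> {1, \<i>} \<Longrightarrow>
      \<exists>y\<in>topspace K. \<forall>f\<in>cfun_space L. T f y = mix c a b f"
  shows "does_SPR K (T ` cfun_space L)"
proof -
  let ?E = "cfun_space L"
  have "(INF l\<in>{l. cmod l = 1}. sup_norm K (\<lambda>x. T f x - l * T g x))
      \<le> 26 * sup_norm K (\<lambda>x. cmod (T f x) - cmod (T g x))" if f: "f \<in> ?E" and g: "g \<in> ?E" for f g
  proof -
    obtain F G where FG: "\<forall>a\<in>A. cmod (a f) \<le> F" "\<forall>a\<in>A. cmod (a g) \<le> G"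
      using bdd[OF f] bdd[OF g] by blast
    have TFG: "cmod (T f y) \<le> F" "cmod (T g y) \<le> G" for y
      using bound[OF f FG(1)] bound[OF g FG(2)] by auto
    define e where "e = sup_norm K (\<lambda>x. cmod (T f x) - cmod (T g x))"
    have e: "\<bar>cmod (T f y) - cmod (T g y)\<bar> \<le> e" if "y \<in> topspace K" for y
    proof -
      have "norm (cmod (T f x) - cmod (T g x)) \<le> F + G" for x
        using TFG[of x] norm_ge_zero[of "T f x"] norm_ge_zero[of "T g x"]
        unfolding real_norm_def by linarith
      then have "bdd_above ((\<lambda>x. norm (cmod (T f x) - cmod (T g x))) ` topspace K)"
        by (auto intro!: bdd_aboveI[of _ "F + G"])
      from norm_le_sup_norm[OF this that] show ?thesis by (simp add: e_def)
    qed
    have "\<exists>l. cmod l = 1 \<and> (\<forall>a\<in>A. cmod (a f - l * a g) \<le> 26 * e)"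
    proof (rule phase_alignment)
      fix a b c assume abc: "a \<in> A" "b \<in> A" "c \<in> {1, \<i>}"
      then obtain y where y: "y \<in> topspace K" "\<forall>f\<in>?E. T f y = mix c a b f" using ev by blast
      then have "\<bar>cmod (mix c a b f) - cmod (mix c a b g)\<bar> \<le> e" using e[OF y(1)] f g by simp
      then show "\<bar>cmod (a f + c * b f) - cmod (a g + c * b g)\<bar> \<le> 2 * e"
        by (simp add: mix_def norm_divide abs_if split: if_splits)
    next
      fix a assume "a \<in> A"
      then show "cmod (a f) \<le> max F G" "cmod (a g) \<le> max F G"
        using FG by (simp_all add: le_max_iff_disj)
    qed fact
    then obtain l where l: "cmod l = 1" "\<forall>a\<in>A. cmod (a f - l * a g) \<le> 26 * e" by blast
    define h where "h = (\<lambda>x. f x + (- l) * g x)"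
    have g': "(\<lambda>x. (- l) * g x) \<in> ?E" using g by (rule cfun_space_cmult)
    then have h: "h \<in> ?E" unfolding h_def by (rule cfun_space_add[OF f])
    have "a h = a f - l * a g" if "a \<in> A" for a
    proof -
      have "a h = a f + a (\<lambda>x. (- l) * g x)"
        using lin_on_add[OF lin[OF that] f g'] by (simp add: h_def)
      moreover have "a (\<lambda>x. (- l) * g x) = (- l) * a g"
        using lin_on_cmult[OF lin[OF that] g] .
      ultimately show ?thesis by simp
    qed
    then have "\<forall>a\<in>A. cmod (a h) \<le> 26 * e" using l(2) by simp
    then have "cmod (T h y) \<le> 26 * e" for y using bound[OF h] by blast
    moreover have "T h y = T f y - l * T g y" for y
    proof -
      have "T h = (\<lambda>y. T f y + T (\<lambda>x. (- l) * g x) y)"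
        using clinear_map_add[OF T f g'] by (simp add: h_def)
      moreover have "T (\<lambda>x. (- l) * g x) = (\<lambda>y. (- l) * T g y)"
        using clinear_map_cmult[OF T g] .
      ultimately show ?thesis by simp
    qed
    ultimately have "sup_norm K (\<lambda>x. T f x - l * T g x) \<le> 26 * e"
      using \<open>topspace K \<noteq> {}\<close> by (intro sup_norm_le) simp_all
    moreover have "(INF l\<in>{l. cmod l = 1}. sup_norm K (\<lambda>x. T f x - l * T g x))
        \<le> sup_norm K (\<lambda>x. T f x - l * T g x)"
    \<comment> \<open>The infimum lies below its members because 0 bounds the family from below,
      which uses a point of \<open>K\<close> and the boundedness of the images.\<close>
    proof (rule cINF_lower)
      show "bdd_below ((\<lambda>l. sup_norm K (\<lambda>x. T f x - l * T g x)) ` {l. cmod l = 1})"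
      proof (rule bdd_belowI2[of _ 0])
        fix k :: complex assume "k \<in> {l. cmod l = 1}"
        then have k: "cmod k = 1" by simp
        obtain y where y: "y \<in> topspace K" using \<open>topspace K \<noteq> {}\<close> by blast
        have "cmod (T f x - k * T g x) \<le> F + G" for x
          using norm_triangle_ineq4[of "T f x" "k * T g x"] TFG[of x] k by (simp add: norm_mult)
        then have "bdd_above ((\<lambda>x. cmod (T f x - k * T g x)) ` topspace K)"
          by (auto intro!: bdd_aboveI[of _ "F + G"])
        from norm_le_sup_norm[OF this y] show "0 \<le> sup_norm K (\<lambda>x. T f x - k * T g x)"
          by (meson norm_ge_zero order_trans)
      qed
    qed (use l in simp)
    ultimately show ?thesis unfolding e_def by linarith
  qed
  note stable = this
  have "does_stable_phase_retrieval 26 K (T ` ?E)"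
    unfolding does_stable_phase_retrieval_def
  proof (intro conjI ballI csubspace_of_image[OF T])
    fix F G assume "F \<in> T ` ?E" "G \<in> T ` ?E"
    then obtain f g where "f \<in> ?E" "F = T f" "g \<in> ?E" "G = T g" by (elim imageE)
    then show "(INF l\<in>{l. cmod l = 1}. sup_norm K (\<lambda>x. F x - l * G x))
        \<le> 26 * sup_norm K (\<lambda>x. cmod (F x) - cmod (G x))"
      by (simp only: stable)
  qed
  then show ?thesis
    unfolding does_SPR_def by (intro exI[of _ 26] conjI) simp_all
qed

section \<open>Functions on intervals of ordinals\<close>

text \<open>Left neighbourhoods suffice, as blocks of ordinals accumulate at \<open>t\<close> from
  below. Positivity of the points of \<open>S\<close> makes \<open>b = 0\<close> available for the
  generating sets without a lower bound.\<close>

lemma order_topology_on_left_neighbourhood: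
  fixes S :: "omega1 set"
  assumes "openin (order_topology_on S) U" "t \<in> U" "\<And>s. s \<in> S \<Longrightarrow> 0 < s"
  shows "\<exists>b<t. \<forall>s\<in>S. b < s \<and> s \<le> t \<longrightarrow> s \<in> U"
proof -
  have "generate_topology_on
      ({S} \<union> {{x\<in>S. x < a} |a. a \<in> S} \<union> {{x\<in>S. a < x} |a. a \<in> S}) U"
    using assms(1) unfolding order_topology_on_def by (rule openin_topology_generated_by)
  then show ?thesis using assms(2)
  proof (induction arbitrary: t)
    case (Int V W)
    then have "t \<in> V" "t \<in> W" by auto
    obtain b where "b < t" "\<forall>s\<in>S. b < s \<and> s \<le> t \<longrightarrow> s \<in> V"
      using Int.IH(1)[OF \<open>t \<in> V\<close>] by blast
    moreover obtain c where "c < t" "\<forall>s\<in>S. c < s \<and> s \<le> t \<longrightarrow> s \<in> W"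
      using Int.IH(2)[OF \<open>t \<in> W\<close>] by blast
    ultimately show ?case by (intro exI[of _ "max b c"]) auto
  next
    case (UN \<U>)
    then obtain V where "V \<in> \<U>" "t \<in> V" by blast
    then obtain b where "b < t" "\<forall>s\<in>S. b < s \<and> s \<le> t \<longrightarrow> s \<in> V"
      using UN.IH[OF \<open>V \<in> \<U>\<close> \<open>t \<in> V\<close>] by blast
    then show ?case using \<open>V \<in> \<U>\<close> by blast
  next
    case (Basis V)
    then consider "V = S" | a where "a \<in> S" "V = {x\<in>S. x < a}" | a where "a \<in> S" "V = {x\<in>S. a < x}"
      by blast
    then show ?case
    proof cases
      case 3
      then show ?thesis using Basis.prems by (intro exI[of _ a]) auto
    qed (use Basis.prems assms(3) in \<open>auto intro!: exI[of _ 0]\<close>)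
  qed simp
qed

lemma topspace_omega_interval [simp]: "topspace (omega_interval g) = {1..omega_pow g}"
  by (simp add: omega_interval_def)

lemma cfun_space_left_continuous:
  assumes f: "f \<in> cfun_space (omega_interval g)" and t: "0 < t" "t \<le> omega_pow g" and "0 < e"
  shows "\<exists>b<t. \<forall>s. b < s \<and> s \<le> t \<longrightarrow> cmod (f s - f t) < e"
proof -
  let ?U = "{s \<in> {1..omega_pow g}. f s \<in> ball (f t) e}"
  have "continuous_map (omega_interval g) euclidean f" using f by (simp add: cfun_space_def)
  then have "openin (omega_interval g) {s \<in> topspace (omega_interval g). f s \<in> ball (f t) e}"
    by (rule openin_continuous_map_preimage) simp
  then have "openin (order_topology_on {1..omega_pow g}) ?U"
    by (simp add: omega_interval_def)
  moreover have "t \<in> ?U" using t \<open>0 < e\<close> by (simp add: one_le_omega1_iff)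
  ultimately obtain b where b: "b < t" "\<forall>s\<in>{1..omega_pow g}. b < s \<and> s \<le> t \<longrightarrow> s \<in> ?U"
    using order_topology_on_left_neighbourhood[of "{1..omega_pow g}" ?U t]
    by (auto simp: one_le_omega1_iff)
  have "cmod (f s - f t) < e" if "b < s" "s \<le> t" for s
  proof -
    have "0 < s" using that(1) zero_le_omega1 le_less_trans by blast
    then have "s \<in> ?U" using b(2) that t by (auto simp: one_le_omega1_iff)
    then show ?thesis by (simp add: dist_norm norm_minus_commute)
  qed
  then show ?thesis using b(1) by blast
qed

definition evaluation :: "omega1 \<Rightarrow> (omega1 \<Rightarrow> complex) \<Rightarrow> complex"
  where "evaluation s f = f s"

text \<open>The pieces are the intervals between consecutive terms of a sequence cofinal in
  \<open>t\<close>; by left continuity only finitely many of them deviate by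
  \<open>e\<close>.\<close>

lemma cb_system_evaluations_limit:
  fixes c :: "nat \<Rightarrow> omega1"
  assumes c: "\<And>n. c n < c (Suc n)" "\<And>n. c n < t" "\<And>s. s < t \<Longrightarrow> \<exists>n. s < c n"
    and pieces: "\<And>n. \<exists>r<g. cb_system (cfun_space (omega_interval G)) r
      (evaluation (c (Suc n))) (evaluation ` {c n<..c (Suc n)})"
    and t: "t \<le> omega_pow G"
  shows "cb_system (cfun_space (omega_interval G)) g (evaluation t) (evaluation ` {c 0<..t})"
proof (rule cb_systemI[of "range (\<lambda>n. evaluation ` {c n<..c (Suc n)})"])
  fix B assume "B \<in> range (\<lambda>n. evaluation ` {c n<..c (Suc n)})"
  then show "\<exists>r<g. \<exists>t. cb_system (cfun_space (omega_interval G)) r t B"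
    using pieces by fastforce
next
  fix f e assume fe: "f \<in> cfun_space (omega_interval G)" "(0::real) < e"
  have "0 < t" using c(2)[of 0] zero_le_omega1 le_less_trans by blast
  then obtain b where b: "b < t" "\<forall>s. b < s \<and> s \<le> t \<longrightarrow> cmod (f s - f t) < e"
    using cfun_space_left_continuous[OF fe(1) _ t fe(2)] by blast
  obtain N where N: "b < c N" using c(3)[OF b(1)] by blast
  have mono: "c i \<le> c j" if "i \<le> j" for i j
    using lift_Suc_mono_le[of c i j, OF less_imp_le[OF c(1)] that] .
  have "n < N" if n: "a \<in> evaluation ` {c n<..c (Suc n)}" "e \<le> cmod (a f - evaluation t f)" for n a
  proof (rule ccontr)
    assume "\<not> n < N"
    then have "b < c n" using N mono[of N n] by auto
    moreover obtain s where s: "c n < s" "s \<le> c (Suc n)" "a = evaluation s" using n(1) by auto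
    moreover have "s \<le> t" using s(2) c(2)[of "Suc n"] by simp
    ultimately have "cmod (f s - f t) < e" using b(2) less_trans by blast
    then show False using n(2) s(3) by (simp add: evaluation_def)
  qed
  then have "{B \<in> range (\<lambda>n. evaluation ` {c n<..c (Suc n)}).
      \<exists>a\<in>B. e \<le> cmod (a f - evaluation t f)} \<subseteq> (\<lambda>n. evaluation ` {c n<..c (Suc n)}) ` {..<N}"
    by blast
  then show "finite {B \<in> range (\<lambda>n. evaluation ` {c n<..c (Suc n)}).
      \<exists>a\<in>B. e \<le> cmod (a f - evaluation t f)}"
    by (rule finite_subset) simp
next
  have cover: "s \<in> insert t (\<Union>n. {c n<..c (Suc n)})" if s: "c 0 < s" "s \<le> t" for s
  proof (cases "s = t")
    case False
    then have "s < t" using s(2) by simp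
    then obtain n where "s \<le> c n" using c(3) less_imp_le by blast
    then have "\<exists>k. c k < s \<and> s \<le> c (Suc k)"
    proof (induction n)
      case 0
      then show ?case using s(1) by simp
    next
      case (Suc n)
      show ?case
      proof (cases "s \<le> c n")
        case True
        then show ?thesis by (rule Suc.IH)
      next
        case False
        then show ?thesis using Suc.prems by (auto intro!: exI[of _ n])
      qed
    qed
    then show ?thesis by auto
  qed simp
  have inside: "c 0 < s \<and> s \<le> t" if "c n < s" "s \<le> c (Suc n)" for n s
  proof -
    have "c 0 \<le> c n" using lift_Suc_mono_le[of c 0 n, OF less_imp_le[OF c(1)]] by simp
    then show ?thesis using that c(2)[of "Suc n"] by (intro conjI) order+
  qed
  have "{c 0<..t} = insert t (\<Union>n. {c n<..c (Suc n)})"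
  proof (intro equalityI subsetI)
    fix s assume "s \<in> {c 0<..t}"
    then show "s \<in> insert t (\<Union>n. {c n<..c (Suc n)})" using cover[of s] by simp
  next
    fix s assume "s \<in> insert t (\<Union>n. {c n<..c (Suc n)})"
    then show "s \<in> {c 0<..t}" using c(2)[of 0] inside by auto
  qed
  then show "evaluation ` {c 0<..t} = insert (evaluation t)
      (\<Union> (range (\<lambda>n. evaluation ` {c n<..c (Suc n)})))"
    by (simp add: image_UN)
qed simp

text \<open>The left end \<open>b\<close> is free, so that the induction covers truncated intervals:
  cutting at a cofinal sequence yields blocks that are final parts of intervals with a smaller
  exponent.\<close>

lemma cb_system_evaluations:
  "a \<le> b \<Longrightarrow> b < ord_add a (omega_pow g) \<Longrightarrow> ord_add a (omega_pow g) \<le> omega_pow G \<Longrightarrow>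
    cb_system (cfun_space (omega_interval G)) g (evaluation (ord_add a (omega_pow g)))
      (evaluation ` {b<..ord_add a (omega_pow g)})"
proof (induction g arbitrary: a b rule: less_induct)
  case (less g)
  let ?t = "ord_add a (omega_pow g)"
  show ?case
  proof (cases g rule: omega1_cases)
    case 1
    then have t: "?t = osuc a" by (simp flip: osuc_zero)
    then have "b = a" using less.prems by simp
    moreover have "{a<..osuc a} = {osuc a}"
      by (auto simp: less_osuc) (metis osuc_le_iff order.antisym)
    ultimately show ?thesis unfolding t by (simp add: cb_system_singleton)
  next
    case (2 e)
    let ?d = "omega_pow e"
    let ?p = "\<lambda>n. ord_add a (ord_times_nat ?d n)"
    have e: "e < g" using 2 less_osuc by simp
    have "\<exists>n. s < ?p n" if s: "s < ?t" for s
    proof -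
      obtain y where "y < omega_pow g" "s \<le> ord_add a y"
        using ord_add_lessD'[OF s] by auto
      moreover obtain n where "y < ord_times_nat ?d n"
        using \<open>y < omega_pow g\<close> 2 less_ord_mult_omega_D[of y ?d] by auto
      ultimately show ?thesis using ord_add_strict_mono le_less_trans by blast
    qed
    note cofinal = this
    \<comment> \<open>The cofinal sequence starts at \<open>b\<close> and continues with the points
      a + omega^e * j above \<open>b\<close>; \<open>k\<close> is the last index whose point is not
      above \<open>b\<close>.\<close>
    define n where "n = (LEAST n. b < ?p n)"
    have n: "b < ?p n" unfolding n_def using cofinal[OF less.prems(2)] by (rule LeastI_ex)
    then have "n \<noteq> 0" using less.prems(1) by (cases n) auto
    then obtain k where k: "n = Suc k" by (cases n) auto
    then have "\<not> b < ?p k" using not_less_Least[of k "\<lambda>n. b < ?p n"] by (simp add: n_def)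
    then have pk: "?p k \<le> b" by simp
    define c where "c i = (if i = 0 then b else ?p (k + i))" for i
    have p_Suc: "?p (Suc j) = ord_add (?p j) ?d" for j by (simp add: ord_add_assoc)
    have p_less: "?p j < ?t" for j
      using ord_add_strict_mono ord_times_nat_less_ord_mult_omega 2 by simp
    have c_bounds: "?p (k + i) \<le> c i" "c i < ?p (Suc (k + i))" for i
      using pk n k ord_add_strict_mono[OF ord_times_nat_less_Suc[OF omega_pow_pos]]
      by (auto simp: c_def simp del: ord_times_nat_simps)
    have c_Suc: "c (Suc i) = ord_add (?p (k + i)) ?d" for i
      using p_Suc[of "k + i"] by (simp add: c_def del: ord_times_nat_simps)
    have "cb_system (cfun_space (omega_interval G)) g (evaluation ?t) (evaluation ` {c 0<..?t})"
    proof (rule cb_system_evaluations_limit)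
      show "c i < c (Suc i)" for i using c_bounds(2)[of i] c_Suc[of i] p_Suc[of "k + i"] by metis
      show c_less: "c i < ?t" for i using less.prems(2) p_less by (simp add: c_def)
      show "\<exists>i. s < c i" if s: "s < ?t" for s
      proof -
        obtain j where "s < ?p j" using cofinal[OF s] by blast
        also have "\<dots> \<le> ?p (k + Suc j)" by (intro ord_add_mono ord_times_nat_mono) simp
        finally have "s < c (Suc j)" by (simp add: c_def del: ord_times_nat_simps)
        then show ?thesis by blast
      qed
      show "\<exists>r<g. cb_system (cfun_space (omega_interval G)) r (evaluation (c (Suc i)))
          (evaluation ` {c i<..c (Suc i)})" for i
        using less.IH[OF e c_bounds(1)[of i]] c_bounds(2)[of i] c_less[of "Suc i"] less.prems(3) e
        unfolding c_Suc p_Suc by (meson less_imp_le less_le_trans)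
    qed (use less.prems in simp)
    then show ?thesis by (simp add: c_def)
  next
    case 3
    define q where "q = from_nat_into {..<g}"
    have ne: "{..<g} \<noteq> {}" using limit_ord_pos[OF 3] by auto
    have q: "q n < g" for n using from_nat_into[OF ne, of n] by (simp add: q_def)
    have q_surj: "\<exists>n. q n = y" if "y < g" for y
      using that ne countable_lessThan_omega1[of g] from_nat_into_surj[of "{..<g}" y] by (auto simp: q_def)
    \<comment> \<open>The enumeration \<open>q\<close> of the exponents below \<open>g\<close>
      drives the choice: step \<open>n\<close> uses an exponent at least \<open>q n\<close>, which
      makes the sequence cofinal.\<close>
    define Q where "Q n s s' \<longleftrightarrow> (\<exists>y<g. q n \<le> y \<and> s' = ord_add a (omega_pow y) \<and> s < s')"
      for n s s'
    have below: "\<exists>y<g. s < ord_add a (omega_pow y)" if s: "s < ?t" for s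
    proof -
      obtain y where y: "y < omega_pow g" "s \<le> ord_add a y" using ord_add_lessD'[OF s] by auto
      then obtain z where "z < g" "y < omega_pow z" using less_omega_pow_limit_D[OF 3] by blast
      then show ?thesis using y ord_add_strict_mono le_less_trans by blast
    qed
    have mono: "ord_add a (omega_pow y) \<le> ord_add a (omega_pow z)" if "y \<le> z" for y z
      using that by (intro ord_add_mono omega_pow_mono)
    have step: "\<exists>s'. (a \<le> s' \<and> s' < ?t \<and> (Suc n = 0 \<longrightarrow> s' = b)) \<and> Q n s s'"
      if s: "a \<le> s \<and> s < ?t \<and> (n = 0 \<longrightarrow> s = b)" for n s
    proof -
      obtain z where z: "z < g" "s < ord_add a (omega_pow z)" using below s by blast
      define y where "y = max z (q n)"
      have y: "y < g" "q n \<le> y" using z(1) q by (auto simp: y_def)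
      have "s < ord_add a (omega_pow y)" using z(2) mono[of z y] by (auto simp: y_def)
      moreover have "ord_add a (omega_pow y) < ?t"
        using y(1) by (intro ord_add_strict_mono omega_pow_strict_mono)
      ultimately show ?thesis
        using y ord_add_ge[of a "omega_pow y"] unfolding Q_def
        by (intro exI[of _ "ord_add a (omega_pow y)"]) auto
    qed
    have "\<exists>s. a \<le> s \<and> s < ?t \<and> ((0::nat) = 0 \<longrightarrow> s = b)" using less.prems by simp
    then have "\<exists>c. \<forall>n. (a \<le> c n \<and> c n < ?t \<and> (n = 0 \<longrightarrow> c n = b)) \<and> Q n (c n) (c (Suc n))"
      by (rule dependent_nat_choice) (rule step)
    then obtain c where "\<forall>n. (a \<le> c n \<and> c n < ?t \<and> (n = 0 \<longrightarrow> c n = b)) \<and> Q n (c n) (c (Suc n))"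
      by (elim exE)
    then have c: "\<And>n. a \<le> c n \<and> c n < ?t \<and> (n = 0 \<longrightarrow> c n = b)" "\<And>n. Q n (c n) (c (Suc n))"
      by blast+
    have "cb_system (cfun_space (omega_interval G)) g (evaluation ?t) (evaluation ` {c 0<..?t})"
    proof (rule cb_system_evaluations_limit)
      show c_less: "c i < c (Suc i)" for i using c(2)[of i] by (auto simp: Q_def)
      show "c i < ?t" for i using c(1) by blast
      show "\<exists>i. s < c i" if s: "s < ?t" for s
      proof -
        obtain z where z: "z < g" "s < ord_add a (omega_pow z)" using below s by blast
        obtain n where "q n = z" using q_surj z(1) by blast
        moreover obtain y where "q n \<le> y" "c (Suc n) = ord_add a (omega_pow y)"
          using c(2)[of n] unfolding Q_def by blast
        ultimately have "s < c (Suc n)" using less_le_trans[OF z(2) mono[of z y]] by simp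
        then show ?thesis by blast
      qed
      show "\<exists>r<g. cb_system (cfun_space (omega_interval G)) r (evaluation (c (Suc i)))
          (evaluation ` {c i<..c (Suc i)})" for i
      proof -
        obtain y where y: "y < g" "c (Suc i) = ord_add a (omega_pow y)"
          using c(2)[of i] by (auto simp: Q_def)
        have "c (Suc i) \<le> omega_pow G" using c(1)[of "Suc i"] less.prems(3)
          by (meson less_imp_le order_trans)
        then show ?thesis using less.IH[OF y(1), of a "c i"] c(1)[of i] c_less[of i] y(1)
          unfolding y(2) by blast
      qed
    qed (use less.prems in simp)
    then show ?thesis using c(1)[of 0] by simp
  qed
qed

text \<open>Common assembly of both copies: a point of the \<open>r\<close>-th derivative carries a
  realization of all mixes of \<open>A\<close>, and \<open>does_SPR_of_mixes\<close> yields stable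
  phase retrieval. The top 0 joins the mixes for \<open>c = 1\<close> and \<open>c = \<i>\<close>
  into one system.\<close>

lemma ex_SPR_embedding:
  fixes A :: "(('l \<Rightarrow> complex) \<Rightarrow> complex) set"
  assumes K: "compact_space K" "Hausdorff_space K"
    and x: "x \<in> cb_derivative K r"
    and sys: "cb_system (cfun_space L) r (\<lambda>f. 0) (insert (\<lambda>f. 0) (mixes 1 A A \<union> mixes \<i> A A))"
    and "A \<noteq> {}" and lin: "\<And>a. a \<in> A \<Longrightarrow> lin_on (cfun_space L) a"
    and bdd: "\<And>f. f \<in> cfun_space L \<Longrightarrow> \<exists>B. \<forall>a\<in>A. cmod (a f) \<le> B"
  shows "\<exists>T. clinear_map L K T \<and> does_SPR K (T ` cfun_space L) \<and>
    (\<forall>f\<in>cfun_space L. \<forall>B. (\<forall>a\<in>A. cmod (a f) \<le> B) \<longrightarrow> (\<forall>y. cmod (T f y) \<le> B)) \<and>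
    (\<forall>a\<in>A. \<exists>y\<in>topspace K. \<forall>f\<in>cfun_space L. T f y = a f)"
proof -
  let ?E = "cfun_space L"
  define Z where "Z = insert (\<lambda>f. 0) (mixes 1 A A \<union> mixes \<i> A A)"
  have linZ: "lin_on ?E z" if "z \<in> Z" for z
  proof -
    have "lin_on ?E (mix c a b)" if "a \<in> A" "b \<in> A" for a b c
      using lin_on_combination[OF lin[OF that(1)] lin[OF that(2)], of "1 / 2" "c / 2"]
      by (simp add: mix_def[abs_def] add_divide_distrib)
    moreover have "lin_on ?E (\<lambda>f. 0)" by (simp add: lin_on_def)
    ultimately show ?thesis using that by (auto simp: Z_def mixes_def)
  qed
  have xK: "x \<in> topspace K" using subsetD[OF cb_derivative_subset_topspace x] .
  obtain S where "realizes K ?E Z (topspace K) S"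
    using cb_system_realizes[OF K sys[folded Z_def] _ x openin_topspace xK] linZ by blast
  then have S: "\<And>f. f \<in> ?E \<Longrightarrow> continuous_map K euclidean (S f)"
    "\<And>f y. y \<notin> topspace K \<Longrightarrow> S f y = 0" "\<And>y. lin_on ?E (\<lambda>f. S f y)"
    "\<And>f W y. f \<in> ?E \<Longrightarrow> convex W \<Longrightarrow> 0 \<in> W \<Longrightarrow> \<forall>a\<in>Z. a f \<in> W \<Longrightarrow> S f y \<in> W"
    "\<And>a. a \<in> Z \<Longrightarrow> \<exists>y\<in>topspace K. \<forall>f\<in>?E. S f y = a f"
    unfolding realizes_def by simp_all
  have T: "clinear_map L K S"
    unfolding clinear_map_def
  proof (intro conjI ballI allI)
    show "S ` ?E \<subseteq> cfun_space K" using S(1,2) by (auto simp: cfun_space_def)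
  qed (use lin_on_add[OF S(3)] lin_on_cmult[OF S(3)] in \<open>auto simp: fun_eq_iff\<close>)
  have bound: "cmod (S f y) \<le> B" if f: "f \<in> ?E" and B: "\<forall>a\<in>A. cmod (a f) \<le> B" for f B y
  proof -
    have "0 \<le> B" using \<open>A \<noteq> {}\<close> B norm_ge_zero order_trans by blast
    have "cmod (mix c a b f) \<le> B" if "a \<in> A" "b \<in> A" "cmod c = 1" for a b c
      using norm_triangle_ineq[of "a f" "c * b f"] B[rule_format, OF that(1)] B[rule_format, OF that(2)]
        that(3) by (simp add: mix_def norm_divide norm_mult)
    then have "\<forall>a\<in>Z. a f \<in> cball 0 B" using \<open>0 \<le> B\<close> by (auto simp: Z_def mixes_def)
    then have "S f y \<in> cball 0 B" using \<open>0 \<le> B\<close> by (intro S(4)[OF f]) auto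
    then show ?thesis by simp
  qed
  have ev: "\<exists>y\<in>topspace K. \<forall>f\<in>?E. S f y = mix c a b f" if "a \<in> A" "b \<in> A" "c \<in> {1, \<i>}" for a b c
    by (rule S(5)) (use that in \<open>auto simp: Z_def mixes_def\<close>)
  have "does_SPR K (S ` ?E)"
    by (rule does_SPR_of_mixes[OF T _ \<open>A \<noteq> {}\<close> lin bdd bound ev]) (use xK in auto)
  moreover have "\<exists>y\<in>topspace K. \<forall>f\<in>?E. S f y = a f" if "a \<in> A" for a
    using ev[OF that that, of 1] by (simp add: mix_def)
  ultimately show ?thesis using T bound by (intro exI[of _ S] conjI ballI allI impI) simp_all
qed

section \<open>The isometric and the isomorphic copy\<close>

lemma lin_on_evaluation: "lin_on E (evaluation s)"
  by (simp add: lin_on_def evaluation_def)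

lemma cb_system_omega_interval:
  "cb_system (cfun_space (omega_interval g)) g (evaluation (omega_pow g))
    (evaluation ` {1..omega_pow g})"
proof -
  have "{0<..omega_pow g} = {1..omega_pow g}" by (auto simp: one_le_omega1_iff)
  then show ?thesis using cb_system_evaluations[of 0 0 g g] by simp
qed

text \<open>Boundedness of a continuous function on the interval comes from the system of
  evaluations instead of compactness.\<close>

lemma cmod_le_sup_norm_omega_interval:
  assumes "f \<in> cfun_space (omega_interval g)" "s \<in> {1..omega_pow g}"
  shows "cmod (f s) \<le> sup_norm (omega_interval g) f"
proof (rule norm_le_sup_norm)
  obtain B where "\<forall>a\<in>evaluation ` {1..omega_pow g}. cmod (a f) \<le> B"
    using cb_system_bounded[OF cb_system_omega_interval assms(1)] by blast
  then show "bdd_above ((\<lambda>x. cmod (f x)) ` topspace (omega_interval g))"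
    by (auto simp: evaluation_def intro!: bdd_aboveI[of _ B])
qed (use assms in simp)

lemma omega_interval_nonempty: "{1..omega_pow g} \<noteq> {}"
  by (simp add: one_le_omega1_iff)

text \<open>The mixes have rank below omega^b, because the natural sum of \<open>g\<close> with
  itself does. Those for \<open>c = 1\<close> and \<open>c = \<i>\<close> have different tops and
  become two pieces under the added top 0. The map is isometric since every evaluation is
  realized.\<close>

lemma contains_isometric_SPR_copy_omega_interval:
  assumes K: "compact_space K" "Hausdorff_space K" "cb_derivative K (omega_pow b) \<noteq> {}"
    and g: "g < omega_pow b"
  shows "contains_isometric_SPR_copy K (omega_interval g)"
proof -
  let ?L = "omega_interval g"
  let ?E = "cfun_space ?L" and ?A = "evaluation ` {1..omega_pow g}"
  obtain x where x: "x \<in> cb_derivative K (omega_pow b)" using K(3) by blast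
  have mixes: "\<exists>s<omega_pow b. \<exists>t. cb_system ?E s t (mixes c ?A ?A)" if "cmod c = 1" for c
    using cb_system_mixes[OF that cb_system_omega_interval cb_system_omega_interval]
      hsum_less_omega_pow[OF g g] by blast
  have sys: "cb_system ?E (omega_pow b) (\<lambda>f. 0)
      (insert (\<lambda>f. 0) (mixes 1 ?A ?A \<union> mixes \<i> ?A ?A))"
    using cb_system_finite_pieces[of "{mixes 1 ?A ?A, mixes \<i> ?A ?A}" "omega_pow b" ?E "\<lambda>f. 0"]
      mixes[of 1] mixes[of \<i>] by auto
  have "\<exists>T. clinear_map ?L K T \<and> does_SPR K (T ` ?E) \<and>
    (\<forall>f\<in>?E. \<forall>B. (\<forall>a\<in>?A. cmod (a f) \<le> B) \<longrightarrow> (\<forall>y. cmod (T f y) \<le> B)) \<and>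
    (\<forall>a\<in>?A. \<exists>y\<in>topspace K. \<forall>f\<in>?E. T f y = a f)"
  proof (rule ex_SPR_embedding[OF K(1,2) x sys])
    show "?A \<noteq> {}" using omega_interval_nonempty by blast
    show "lin_on ?E a" if "a \<in> ?A" for a using that lin_on_evaluation by blast
    show "\<exists>B. \<forall>a\<in>?A. cmod (a f) \<le> B" if "f \<in> ?E" for f
      using cb_system_bounded[OF cb_system_omega_interval that] .
  qed
  then obtain T where T12: "clinear_map ?L K T" "does_SPR K (T ` ?E)"
    and T3: "\<forall>f\<in>?E. \<forall>B. (\<forall>a\<in>?A. cmod (a f) \<le> B) \<longrightarrow> (\<forall>y. cmod (T f y) \<le> B)"
    and T4: "\<forall>a\<in>?A. \<exists>y\<in>topspace K. \<forall>f\<in>?E. T f y = a f"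
    by (elim exE conjE)
  have T3: "cmod (T f y) \<le> B" if "f \<in> ?E" "\<forall>a\<in>?A. cmod (a f) \<le> B" for f B y
    using T3 that by simp
  have "sup_norm K (T f) = sup_norm ?L f" if f: "f \<in> ?E" for f
  proof (rule order.antisym)
    have le: "cmod (T f y) \<le> sup_norm ?L f" for y
      using cmod_le_sup_norm_omega_interval[OF f] by (intro T3[OF f]) (auto simp: evaluation_def)
    have "topspace K \<noteq> {}" using subsetD[OF cb_derivative_subset_topspace x] by blast
    then show "sup_norm K (T f) \<le> sup_norm ?L f" using le by (rule sup_norm_le)
    show "sup_norm ?L f \<le> sup_norm K (T f)"
    proof (rule sup_norm_le)
      fix s assume "s \<in> topspace ?L"
      then obtain y where y: "y \<in> topspace K" "T f y = f s"
        using bspec[OF T4, of "evaluation s"] f by (auto simp: evaluation_def)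
      have "cmod (T f y) \<le> sup_norm K (T f)"
        using le by (intro norm_le_sup_norm y(1)) (auto intro!: bdd_aboveI)
      then show "cmod (f s) \<le> sup_norm K (T f)" by (simp add: y(2))
    qed (use omega_interval_nonempty in simp)
  qed
  then show ?thesis
    using T12 unfolding contains_isometric_SPR_copy_def isometric_embedding_def by blast
qed

text \<open>Passing to differences of evaluations lowers the rank to omega^b with top 0, so their
  mixes fit at one point of the derivative of order omega^b * 2. The price is distortion: the map
  has norm at most 2 and its inverse at most \<open>C\<close>.\<close>

lemma contains_isomorphic_SPR_copy_omega_interval:
  assumes K: "compact_space K" "Hausdorff_space K"
    and ne: "cb_derivative K (ord_add (omega_pow b) (omega_pow b)) \<noteq> {}"
    and g: "g < omega_pow (osuc b)"
  shows "contains_isomorphic_SPR_copy K (omega_interval g)"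
proof -
  let ?L = "omega_interval g" and ?d = "omega_pow b"
  let ?E = "cfun_space ?L" and ?A = "insert (\<lambda>f. 0) (evaluation ` {1..omega_pow g})"
  obtain x where x: "x \<in> cb_derivative K (ord_add ?d ?d)" using ne by blast
  obtain n where "g < ord_times_nat ?d n" using g less_ord_mult_omega_D[of g ?d] by auto
  then have n: "osuc g < ord_times_nat ?d (Suc n)"
    using ord_times_nat_less_Suc[of ?d n] by (metis le_less_trans omega_pow_pos osuc_le_iff)
  \<comment> \<open>The zero functional becomes the top and the evaluations a single piece, which
    raises the rank by one; differences measured from 0 then control the evaluations
    themselves.\<close>
  have "cb_system ?E (osuc g) (\<lambda>f. 0) ?A"
    using cb_system_finite_pieces[of "{evaluation ` {1..omega_pow g}}" "osuc g" ?E]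
      cb_system_omega_interval[of g] less_osuc by auto
  then obtain C M where M: "0 \<le> C" "cb_system ?E ?d (\<lambda>f. 0) M" "M \<subseteq> differences ?A"
    "norms_differences ?E C M (\<lambda>f. 0) ?A"
    using ex_cb_system_differences[of ?d "Suc n" ?E] n omega_pow_pos by blast
  have zero: "mix c (\<lambda>f. 0) (\<lambda>f. 0) = (\<lambda>f :: omega1 \<Rightarrow> complex. 0)" for c
    by (simp add: mix_def fun_eq_iff)
  have mixes: "cb_system ?E (ord_add ?d ?d) (\<lambda>f. 0) (mixes c M M)" if "cmod c = 1" for c
    using cb_system_mono[OF cb_system_mixes[OF that M(2) M(2)] hsum_omega_pow_le] by (simp add: zero)
  have "cb_system ?E (ord_add ?d ?d) (\<lambda>f. 0) (mixes 1 M M \<union> mixes \<i> M M)"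
    by (intro cb_system_union mixes) simp_all
  moreover have "(\<lambda>f. 0) \<in> mixes 1 M M" using cb_system_top[OF mixes[of 1]] by simp
  ultimately have sys: "cb_system ?E (ord_add ?d ?d) (\<lambda>f. 0)
      (insert (\<lambda>f. 0) (mixes 1 M M \<union> mixes \<i> M M))"
    by (simp add: insert_absorb)
  have "\<exists>T. clinear_map ?L K T \<and> does_SPR K (T ` ?E) \<and>
    (\<forall>f\<in>?E. \<forall>B. (\<forall>a\<in>M. cmod (a f) \<le> B) \<longrightarrow> (\<forall>y. cmod (T f y) \<le> B)) \<and>
    (\<forall>a\<in>M. \<exists>y\<in>topspace K. \<forall>f\<in>?E. T f y = a f)"
  proof (rule ex_SPR_embedding[OF K(1,2) x sys])
    show "M \<noteq> {}" using cb_system_top[OF M(2)] by blast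
    show "\<exists>B. \<forall>a\<in>M. cmod (a f) \<le> B" if "f \<in> ?E" for f
      using cb_system_bounded[OF M(2) that] .
    fix a assume "a \<in> M"
    then obtain u v where uv: "u \<in> ?A" "v \<in> ?A" "a = (\<lambda>f. u f - v f)"
      using subsetD[OF M(3) \<open>a \<in> M\<close>] unfolding differences_def by blast
    have "lin_on ?E w" if "w \<in> ?A" for w
      using that lin_on_evaluation by (auto simp: lin_on_def evaluation_def)
    then show "lin_on ?E a" unfolding uv(3) using uv(1,2) by (intro lin_on_diff)
  qed
  then obtain T where T12: "clinear_map ?L K T" "does_SPR K (T ` ?E)"
    and T3: "\<forall>f\<in>?E. \<forall>B. (\<forall>a\<in>M. cmod (a f) \<le> B) \<longrightarrow> (\<forall>y. cmod (T f y) \<le> B)"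
    and T4: "\<forall>a\<in>M. \<exists>y\<in>topspace K. \<forall>f\<in>?E. T f y = a f"
    by (elim exE conjE)
  have T3: "cmod (T f y) \<le> B" if "f \<in> ?E" "\<forall>a\<in>M. cmod (a f) \<le> B" for f B y
    using T3 that by simp
  have Kne: "topspace K \<noteq> {}" using subsetD[OF cb_derivative_subset_topspace x] by blast
  have le: "cmod (T f y) \<le> 2 * sup_norm ?L f" if f: "f \<in> ?E" for f y
  proof (intro T3[OF f] ballI)
    fix a assume "a \<in> M"
    then obtain u v where uv: "u \<in> ?A" "v \<in> ?A" "a = (\<lambda>f. u f - v f)"
      using subsetD[OF M(3) \<open>a \<in> M\<close>] unfolding differences_def by blast
    have "0 \<le> sup_norm ?L f"
      using cmod_le_sup_norm_omega_interval[OF f, of 1] norm_ge_zero order_trans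
      by (metis atLeastAtMost_iff omega_pow_pos one_le_omega1_iff order.refl)
    then have w: "cmod (w f) \<le> sup_norm ?L f" if "w \<in> ?A" for w
      using that cmod_le_sup_norm_omega_interval[OF f] by (auto simp: evaluation_def)
    then show "cmod (a f) \<le> 2 * sup_norm ?L f"
      unfolding uv(3) using norm_triangle_ineq4[of "u f" "v f"] w[OF uv(1)] w[OF uv(2)] by simp
  qed
  have upper: "sup_norm K (T f) \<le> 2 * sup_norm ?L f" if "f \<in> ?E" for f
    using Kne le[OF that] by (rule sup_norm_le)
  have point: "cmod (f s) \<le> C * sup_norm K (T f)" if f: "f \<in> ?E" and s: "s \<in> {1..omega_pow g}" for f s
  proof -
    have "cmod (a f) \<le> sup_norm K (T f)" if a: "a \<in> M" for a
    proof -
      obtain y where y: "y \<in> topspace K" "T f y = a f" using bspec[OF T4 a] f by blast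
      have "cmod (T f y) \<le> sup_norm K (T f)"
        using le[OF f] by (intro norm_le_sup_norm y(1)) (auto intro!: bdd_aboveI)
      then show ?thesis by (simp add: y(2))
    qed
    moreover have "evaluation s \<in> ?A" using s by blast
    ultimately have "cmod (evaluation s f - 0) \<le> C * sup_norm K (T f)"
      using M(4) f unfolding norms_differences_def by blast
    then show ?thesis by (simp add: evaluation_def)
  qed
  have lower: "sup_norm ?L f \<le> C * sup_norm K (T f)" if "f \<in> ?E" for f
    using point[OF that] omega_interval_nonempty by (intro sup_norm_le) simp_all
  have "inj_on T ?E"
  proof (rule inj_onI)
    fix f h assume fh: "f \<in> ?E" "h \<in> ?E" "T f = T h"
    have h': "(\<lambda>x. (- 1) * h x) \<in> ?E" using fh(2) by (rule cfun_space_cmult)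
    define k where "k = (\<lambda>x. f x + (- 1) * h x)"
    have k: "k \<in> ?E" unfolding k_def using fh(1) h' by (rule cfun_space_add)
    have "T k = (\<lambda>y. 0)"
      using clinear_map_add[OF T12(1) fh(1) h'] clinear_map_cmult[OF T12(1) fh(2), of "- 1"] fh(3)
      by (simp add: k_def)
    then have "sup_norm K (T k) = 0" using Kne by (simp add: sup_norm_def)
    then have "k s = 0" if "s \<in> {1..omega_pow g}" for s using point[OF k that] by simp
    moreover have "k s = 0" if "s \<notin> {1..omega_pow g}" for s
      using k that by (simp add: cfun_space_def)
    ultimately have "k s = 0" for s by blast
    then show "f = h" by (simp add: k_def fun_eq_iff)
  qed
  then show ?thesis
    using T12 upper lower
    unfolding contains_isomorphic_SPR_copy_def isomorphic_embedding_def by blast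
qed

text \<open>The derivatives may be infinite, where \<open>card\<close> would be 0, so cardinality at
  least 2 is expressed by an injection.\<close>

lemma two_lepoll_iff: "{..<2::nat} \<lesssim> X \<longleftrightarrow> (\<exists>x\<in>X. \<exists>y\<in>X. x \<noteq> y)"
proof
  assume "{..<2::nat} \<lesssim> X"
  then obtain f where f: "inj_on f {..<2::nat}" "f ` {..<2} \<subseteq> X" by (auto simp: lepoll_def)
  then have "f 0 \<noteq> f 1" by (auto dest: inj_onD)
  then show "\<exists>x\<in>X. \<exists>y\<in>X. x \<noteq> y" using f(2) by (metis image_subset_iff lessThan_iff one_less_numeral_iff pos2 semiring_norm(76))
next
  assume "\<exists>x\<in>X. \<exists>y\<in>X. x \<noteq> y"
  then obtain x y where "x \<in> X" "y \<in> X" "x \<noteq> y" by blast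
  then show "{..<2::nat} \<lesssim> X"
    unfolding lepoll_def
    by (intro exI[of _ "\<lambda>n. if n = 0 then x else y"]) (auto simp: inj_on_def)
qed

text \<open>\<open>osuc 1\<close> is the ordinal 2. The last conjunct is the reformulation
  introduced by "that is"; it is restricted to omega^\<beta> * 2 \<le> \<alpha>, since for smaller
  \<alpha> this derivative may still have two points while both alternatives fail.\<close>

theorem corollary3p8:
  fixes K :: "'k topology" and \<alpha> \<beta> :: omega1
  assumes "0 < \<alpha>"
    and "compact_space K" and "Hausdorff_space K"
    and "cb_derivative K \<alpha> \<noteq> {}"
    and "omega_pow \<beta> \<le> \<alpha>" and "\<alpha> < omega_pow (osuc \<beta>)"
  shows "(\<forall>\<gamma> < omega_pow \<beta>. contains_isometric_SPR_copy K (omega_interval \<gamma>))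
    \<and> ({..<2::nat} \<lesssim> cb_derivative K (ord_mult (omega_pow \<beta>) (osuc 1)) \<longrightarrow>
         contains_isomorphic_SPR_copy K (omega_interval \<alpha>))
    \<and> (ord_mult (omega_pow \<beta>) (osuc 1) \<le> \<alpha> \<longrightarrow>
         ({..<2::nat} \<lesssim> cb_derivative K (ord_mult (omega_pow \<beta>) (osuc 1)) \<longleftrightarrow>
           ord_mult (omega_pow \<beta>) (osuc 1) < \<alpha> \<or>
           \<alpha> = ord_mult (omega_pow \<beta>) (osuc 1) \<and> {..<2::nat} \<lesssim> cb_derivative K \<alpha>))"
proof (intro conjI allI impI)
  fix \<gamma> assume "\<gamma> < omega_pow \<beta>"
  moreover have "cb_derivative K (omega_pow \<beta>) \<noteq> {}"
    using cb_derivative_antimono[OF assms(5), of K] assms(4) by blast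
  ultimately show "contains_isometric_SPR_copy K (omega_interval \<gamma>)"
    using contains_isometric_SPR_copy_omega_interval assms(2,3) by blast
next
  assume "{..<2::nat} \<lesssim> cb_derivative K (ord_mult (omega_pow \<beta>) (osuc 1))"
  then have "cb_derivative K (ord_add (omega_pow \<beta>) (omega_pow \<beta>)) \<noteq> {}"
    unfolding ord_times_nat_two two_lepoll_iff by blast
  then show "contains_isomorphic_SPR_copy K (omega_interval \<alpha>)"
    using contains_isomorphic_SPR_copy_omega_interval assms(2,3,6) by blast
next
  let ?d = "ord_mult (omega_pow \<beta>) (osuc 1)"
  assume le: "?d \<le> \<alpha>"
  \<comment> \<open>A point of the derivative of order \<alpha> is an accumulation point of every
    earlier derivative, which supplies the second point.\<close>
  have "{..<2::nat} \<lesssim> cb_derivative K ?d" if less: "?d < \<alpha>"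
  proof -
    obtain x where x: "x \<in> cb_derivative K \<alpha>" using assms(4) by blast
    then have "x \<in> cb_derivative K ?d" "x \<in> topspace K"
      using cb_derivative_antimono[OF le, of K] cb_derivative_subset_topspace[of K \<alpha>] by blast+
    moreover obtain y where "y \<in> cb_derivative K ?d" "y \<noteq> x"
      using cb_derivative_accumulation[OF x less openin_topspace \<open>x \<in> topspace K\<close>] by blast
    ultimately show ?thesis unfolding two_lepoll_iff by blast
  qed
  then show "{..<2::nat} \<lesssim> cb_derivative K ?d \<longleftrightarrow>
      ?d < \<alpha> \<or> \<alpha> = ?d \<and> {..<2::nat} \<lesssim> cb_derivative K \<alpha>"
    using le by (auto simp: order_le_less)
qed

end
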